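(* Let $t_0\ge0$, $m\ge1$, and let $a,g,b_k,h_k:[0,\infty)\to\mathbb R$ ($k=1,\dots,m$) be Lebesgue measurable functions such that $a,b_k$ are essentially bounded on $[0,\infty)$; $\operatorname{ess\,sup}_{t\ge t_0}|a(t)|\le a_0$ for some constant $a_0<1$; $b_k(t)\ge0$ for $t\ge t_0$; $0\le t-g(t)\le\delta$ and $0\le t-h_k(t)\le\tau_k$ with constants $\delta,\tau_k$; and the set $g^{-1}(E)$ has Lebesgue measure zero whenever $E\subset\mathbb R$ has Lebesgue measure zero. Put $$\bar b(t)=\sum_{k=1}^m b_k(t),\qquad \bar h(t)=\min_k h_k(t),\qquad \bar\tau=\max_k\tau_k>0.$$ Assume that $\bar b(t)\ge\beta>0$ for $t\ge t_0$ with a constant $\beta$, and that at least one of the following conditions holds: (i) $\displaystyle\int_{\bar h(t)}^t\bar b(s)\,ds\le\frac1e$ for $t\ge t_0$, and $\displaystyle\|a\|_{[t_0,\infty)}+\|\bar b\|_{[t_0,\infty)}\left\|\frac{a}{\bar b}\right\|_{[t_0,\infty)}<1$; (ii) $\displaystyle\left\|\frac{a}{b_0}\right\|_{[t_0,\infty)}\frac{\|\bar b\|_{[t_0,\infty)}}{1-\|a\|_{[t_0,\infty)}}+\left\|\frac{\bar b-b_0}{b_0}\right\|_{[t_0,\infty)}<1$, where $b_0(t)=\min\left\{\bar b(t),\frac1{\bar\tau e}\right\}$; (iii) $\displaystyle\|\bar b\|_{[t_0,\infty)}\left(\left\|\frac{a}{\bar b}\right\|_{[t_0,\infty)}+\left\|\left(t-\bar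 h(t)-\frac1{\|\bar b\|_{[t_0,\infty)}e}\right)^+\right\|_{[t_0,\infty)}\right)<1-\|a\|_{[t_0,\infty)}$. Then the equation $\dot x(t)-a(t)\dot x(g(t))=-\sum_{k=1}^m b_k(t)x(h_k(t))$ is exponentially stable.
   Context: Notation: $\|f\|_{[t_0,\infty)}=\operatorname{ess\,sup}_{t\ge t_0}|f(t)|$ (an expression in $t$ inside the norm denotes the corresponding function of $t$); $u^+=\max\{u,0\}$. In integrals over $[\bar h(t),t]$ the coefficients are taken to be $0$ at negative arguments. Solutions: for an initial point $\sigma\ge t_0$ and bounded Borel measurable functions $\varphi:(-\infty,\sigma]\to\mathbb R$, $\psi:(-\infty,\sigma)\to\mathbb R$ (prescribed independently of each other), a solution of the equation with initial conditions $x(t)=\varphi(t)$ for $t\le\sigma$, $\dot x(t)=\psi(t)$ for $t<\sigma$ is a function $x$ that is absolutely continuous on each $[\sigma,c]$, has locally essentially bounded derivative on $[\sigma,\infty)$, and satisfies the equation for almost all $t\ge\sigma$, where $x$ at arguments $\le\sigma$ is replaced by $\varphi$ and $\dot x$ at arguments $<\sigma$ is replaced by $\psi$. The equation is (uniformly) exponentially stable if there exist $M>0$, $\gamma>0$, not depending on $\sigma\ge t_0$, $\varphi$, $\psi$, such that every such solution satisfies $|x(t)|\le M e^{-\gamma(t-\sigma)}\sup_{s\le\sigma}(|\varphi(s)|+|\psi(s)|)$ for $t\ge\sigma$ (with $\psi(\sigma):=0$). *)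

theory Defs
  imports "HOL-Analysis.Analysis" "HOL-Probability.Essential_Supremum"
begin

text \<open>The norm \<open>\<parallel>f\<parallel>\<close> on \<open>[c, \<infinity>)\<close>, valued in the extended reals: it is \<open>\<infinity>\<close> if \<open>f\<close> is
  essentially unbounded (or not Lebesgue measurable) there.\<close>

definition ess_norm :: "real \<Rightarrow> (real \<Rightarrow> real) \<Rightarrow> ereal" where
  "ess_norm c f = esssup (lebesgue_on {c..}) (\<lambda>t. ereal \<bar>f t\<bar>)"

definition abs_continuous_on :: "real \<Rightarrow> real \<Rightarrow> (real \<Rightarrow> real) \<Rightarrow> bool" where
  "abs_continuous_on p q f \<longleftrightarrow>
    (\<forall>\<epsilon>>0. \<exists>\<delta>>0. \<forall>(n::nat) u v.
      (\<forall>i<n. p \<le> u i \<and> u i < v i \<and> v i \<le> q) \<and>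
      disjoint_family_on (\<lambda>i. {u i<..<v i}) {..<n} \<and>
      (\<Sum>i<n. v i - u i) < \<delta> \<longrightarrow>
      (\<Sum>i<n. \<bar>f (v i) - f (u i)\<bar>) < \<epsilon>)"

text \<open>Solutions of \<open>x'(t) - a(t) x'(g(t)) = - (\<Sum>k=1..m. b\<^sub>k(t) x(h\<^sub>k(t)))\<close> with initial
  point \<open>\<sigma>\<close> and initial functions \<open>\<phi>\<close>, \<open>\<psi>\<close>. Only the values of \<open>x\<close> on \<open>[\<sigma>, \<infinity>)\<close>, of \<open>\<phi>\<close> on
  \<open>(-\<infinity>, \<sigma>]\<close> and of \<open>\<psi>\<close> on \<open>(-\<infinity>, \<sigma>)\<close> are relevant; \<open>deriv x\<close> is used at the single point
  \<open>\<sigma>\<close> and at the points of non-differentiability of \<open>x\<close> with an unspecified value, which is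
  immaterial when these null sets have null preimages under \<open>g\<close>.\<close>

definition neutral_solution ::
  "nat \<Rightarrow> (real \<Rightarrow> real) \<Rightarrow> (real \<Rightarrow> real) \<Rightarrow> (nat \<Rightarrow> real \<Rightarrow> real) \<Rightarrow> (nat \<Rightarrow> real \<Rightarrow> real) \<Rightarrow>
   real \<Rightarrow> (real \<Rightarrow> real) \<Rightarrow> (real \<Rightarrow> real) \<Rightarrow> (real \<Rightarrow> real) \<Rightarrow> bool" where
  "neutral_solution m a g b h \<sigma> \<phi> \<psi> x \<longleftrightarrow>
    x \<sigma> = \<phi> \<sigma> \<and>
    (\<forall>c>\<sigma>. abs_continuous_on \<sigma> c x) \<and>
    (\<forall>c>\<sigma>. \<exists>C. AE t in lebesgue_on {\<sigma>..c}. x differentiable (at t) \<and> \<bar>deriv x t\<bar> \<le> C) \<and>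
    (AE t in lebesgue_on {\<sigma>..}.
      deriv x t - a t * (if g t < \<sigma> then \<psi> (g t) else deriv x (g t)) =
      - (\<Sum>k=1..m. b k t * (if h k t \<le> \<sigma> then \<phi> (h k t) else x (h k t))))"

definition exponentially_stable ::
  "real \<Rightarrow> nat \<Rightarrow> (real \<Rightarrow> real) \<Rightarrow> (real \<Rightarrow> real) \<Rightarrow> (nat \<Rightarrow> real \<Rightarrow> real) \<Rightarrow>
   (nat \<Rightarrow> real \<Rightarrow> real) \<Rightarrow> bool" where
  "exponentially_stable t0 m a g b h \<longleftrightarrow>
    (\<exists>M>0. \<exists>\<gamma>>0. \<forall>\<sigma>\<ge>t0. \<forall>\<phi> \<psi> x.
      \<phi> \<in> borel_measurable (restrict_space borel {..\<sigma>}) \<and> bounded (\<phi> ` {..\<sigma>}) \<and>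
      \<psi> \<in> borel_measurable (restrict_space borel {..<\<sigma>}) \<and> bounded (\<psi> ` {..<\<sigma>}) \<and>
      neutral_solution m a g b h \<sigma> \<phi> \<psi> x \<longrightarrow>
      (\<forall>t\<ge>\<sigma>. \<bar>x t\<bar> \<le> M * exp (- \<gamma> * (t - \<sigma>)) *
        (SUP s\<in>{..\<sigma>}. \<bar>\<phi> s\<bar> + \<bar>if s < \<sigma> then \<psi> s else 0\<bar>)))"

end

theory Submission
  imports Defs
begin

text \<open>
  Multiply a solution by a weight: \<open>y(t) = exp (\<mu> (t - \<sigma>)) x(t)\<close> and
  \<open>z(t) = exp (\<mu> (t - \<sigma>)) x'(t)\<close>, with \<open>Y\<close>, \<open>Z\<close> their (essential) suprema over a bounded interval. The equation itself bounds \<open>Z\<close> by \<open>(\<parallel>b\<parallel> Y + const) / (1 - \<parallel>a\<parallel>)\<close>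
  up to factors tending to 1 as \<open>\<mu> \<rightarrow> 0\<close>. With \<open>\<mu> < 0\<close> of large modulus this controls the solution
  on one delay length. For small \<open>\<mu> > 0\<close> one compares with a delay equation
  \<open>y' + \<Sum> c\<^sub>k y(\<eta>\<^sub>k) = f\<close> satisfying the \<open>1/e\<close> condition: its fundamental function is positive, hence
  \<open>|f| \<le> F \<Sum> c\<^sub>k\<close> forces \<open>Y \<le> F + const\<close>. As \<open>F\<close> is linear in \<open>Y\<close> and \<open>Z\<close>, the smallness condition closes
  the estimate uniformly in the interval, and \<open>|x(t)| \<le> Y exp (- \<mu> (t - \<sigma>))\<close>. The three conditions
  correspond to the choices \<open>(c\<^sub>k, \<eta>\<^sub>k) = (b\<^sub>k, h\<^sub>k)\<close>, \<open>(b\<^sub>k b\<^sub>0 / \<Sum> b\<^sub>j, h\<^sub>k)\<close> and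
  \<open>(b\<^sub>k, max h\<^sub>k (t - 1 / (\<parallel>\<Sum> b\<^sub>j\<parallel> e)))\<close>.
\<close>

section \<open>Absolutely continuous functions\<close>

text \<open>Tagged divisions supply families indexed by pairs of a tag and an interval, some of them
  degenerate. Degenerate intervals contribute nothing to either sum; the others are enumerated by
  natural numbers, as the definition of absolute continuity demands.\<close>

lemma abs_continuous_on_finite_family:
  assumes "abs_continuous_on p q f" "\<epsilon> > 0"
  shows "\<exists>\<delta>>0. \<forall>(S :: 'x set) u v. finite S \<longrightarrow> (\<forall>i\<in>S. p \<le> u i \<and> u i \<le> v i \<and> v i \<le> q) \<longrightarrow>
     disjoint_family_on (\<lambda>i. {u i<..<v i}) S \<longrightarrow> (\<Sum>i\<in>S. v i - u i) < \<delta> \<longrightarrow>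
     (\<Sum>i\<in>S. \<bar>f (v i) - f (u i)\<bar>) < \<epsilon>"
proof -
  obtain \<delta> where "\<delta> > 0" and \<delta>: "\<And>(n::nat) u v.
      \<forall>i<n. p \<le> u i \<and> u i < v i \<and> v i \<le> q \<Longrightarrow>
      disjoint_family_on (\<lambda>i. {u i<..<v i}) {..<n} \<Longrightarrow>
      (\<Sum>i<n. v i - u i) < \<delta> \<Longrightarrow> (\<Sum>i<n. \<bar>f (v i) - f (u i)\<bar>) < \<epsilon>"
    using assms(1)[unfolded abs_continuous_on_def, rule_format, OF assms(2)] by blast
  show ?thesis
  proof (intro exI[of _ \<delta>] conjI allI impI \<open>\<delta> > 0\<close>)
    fix S :: "'x set" and u v :: "'x \<Rightarrow> real"
    assume fin: "finite S" and "\<forall>i\<in>S. p \<le> u i \<and> u i \<le> v i \<and> v i \<le> q"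
      and disj: "disjoint_family_on (\<lambda>i. {u i<..<v i}) S" and sm: "(\<Sum>i\<in>S. v i - u i) < \<delta>"
    then have S: "\<And>i. i \<in> S \<Longrightarrow> p \<le> u i \<and> u i \<le> v i \<and> v i \<le> q" by blast
    define S' where "S' = {i \<in> S. u i < v i}"
    have S': "finite S'" "S' \<subseteq> S" using fin by (auto simp: S'_def)
    obtain e where e: "bij_betw e {..<card S'} S'"
      using ex_bij_betw_nat_finite[OF S'(1)] by (auto simp: lessThan_atLeast0)
    have eS: "e i \<in> S'" if "i < card S'" for i
      using e that by (auto simp: bij_betw_def)
    have eq: "u i = v i" if "i \<in> S - S'" for i
      using S[of i] that by (auto simp: S'_def)
    have "(\<Sum>i\<in>S. v i - u i) = (\<Sum>i\<in>S'. v i - u i)"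
      by (rule sum.mono_neutral_right[OF fin S'(2)]) (use eq in auto)
    then have l: "(\<Sum>i<card S'. v (e i) - u (e i)) < \<delta>"
      using sm sum.reindex_bij_betw[OF e, of "\<lambda>i. v i - u i"] by simp
    have d: "disjoint_family_on (\<lambda>i. {u (e i)<..<v (e i)}) {..<card S'}"
      unfolding disjoint_family_on_def
    proof (intro ballI impI)
      fix i j assume ij: "i \<in> {..<card S'}" "j \<in> {..<card S'}" "i \<noteq> j"
      then have "e i \<noteq> e j" using e by (auto simp: bij_betw_def inj_on_def)
      then show "{u (e i)<..<v (e i)} \<inter> {u (e j)<..<v (e j)} = {}"
        using disj eS ij S'(2) unfolding disjoint_family_on_def by blast
    qed
    have "(\<Sum>i<card S'. \<bar>f (v (e i)) - f (u (e i))\<bar>) < \<epsilon>"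
    proof (rule \<delta>[OF _ d l], intro allI impI)
      fix i assume "i < card S'"
      then show "p \<le> u (e i) \<and> u (e i) < v (e i) \<and> v (e i) \<le> q"
        using eS[of i] S[of "e i"] by (simp add: S'_def)
    qed
    moreover have "(\<Sum>i\<in>S. \<bar>f (v i) - f (u i)\<bar>) = (\<Sum>i\<in>S'. \<bar>f (v i) - f (u i)\<bar>)"
      by (rule sum.mono_neutral_right[OF fin S'(2)]) (use eq in auto)
    ultimately show "(\<Sum>i\<in>S. \<bar>f (v i) - f (u i)\<bar>) < \<epsilon>"
      using sum.reindex_bij_betw[OF e, of "\<lambda>i. \<bar>f (v i) - f (u i)\<bar>"] by simp
  qed
qed

text \<open>The errors of the linear approximation at \<open>u\<close> and at \<open>v\<close> are
  at most \<epsilon> times \<open>t - u\<close> and \<open>v - t\<close>; because \<open>t\<close>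
  lies between the endpoints, they add up to \<epsilon> times \<open>v - u\<close>.\<close>

lemma DERIV_straddle:
  fixes f :: "real \<Rightarrow> real"
  assumes "(f has_real_derivative D) (at t)" "\<epsilon> > 0"
  obtains r where "r > 0" "\<And>u v. u \<le> t \<Longrightarrow> t \<le> v \<Longrightarrow> u \<in> ball t r \<Longrightarrow> v \<in> ball t r \<Longrightarrow>
     \<bar>(v - u) * D - (f v - f u)\<bar> \<le> \<epsilon> * (v - u)"
proof -
  have "(f has_derivative (\<lambda>h. h * D)) (at t)"
    using assms(1) by (simp add: has_field_derivative_def mult_commute_abs)
  then obtain r where r: "r > 0" "\<And>w. \<bar>w - t\<bar> < r \<Longrightarrow> \<bar>f w - f t - (w - t) * D\<bar> \<le> \<epsilon> * \<bar>w - t\<bar>"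
    using assms(2) unfolding has_derivative_at_alt by (auto simp: real_norm_def)
  show ?thesis
  proof (rule that[OF r(1)])
    fix u v assume uv: "u \<le> t" "t \<le> v" "u \<in> ball t r" "v \<in> ball t r"
    have "\<bar>f u - f t - (u - t) * D\<bar> \<le> \<epsilon> * \<bar>u - t\<bar>" "\<bar>f v - f t - (v - t) * D\<bar> \<le> \<epsilon> * \<bar>v - t\<bar>"
      by (rule r(2), use uv in \<open>simp add: dist_real_def\<close>)+
    moreover have "\<bar>u - t\<bar> = t - u" "\<bar>v - t\<bar> = v - t" using uv by auto
    ultimately show "\<bar>(v - u) * D - (f v - f u)\<bar> \<le> \<epsilon> * (v - u)"
      by (simp add: algebra_simps abs_le_iff)
  qed
qed

lemma null_set_outer_open:
  fixes N :: "real set"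
  assumes "N \<in> null_sets lebesgue" "\<delta> > 0"
  obtains U where "open U" "N \<subseteq> U" "U \<in> lmeasurable" "measure lebesgue U < \<delta>"
proof -
  have "N \<in> sets lebesgue" using assms by auto
  then obtain U where U: "open U" "N \<subseteq> U" "(U - N) \<in> lmeasurable" "emeasure lebesgue (U - N) < ennreal \<delta>"
    using sets_lebesgue_outer_open assms(2) by metis
  have eq: "emeasure lebesgue U = emeasure lebesgue (U - N)"
    by (metis U(1) assms(1) borel_open emeasure_Diff_null_set sets_completionI_sets sets_lborel)
  then have "U \<in> lmeasurable"
    using U by (intro fmeasurableI) (auto simp: less_top[symmetric])
  moreover have "measure lebesgue U < \<delta>"
    using U(4) eq emeasure_eq_measure2[OF \<open>U \<in> lmeasurable\<close>]
    by (metis ennreal_less_iff measure_nonneg)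
  ultimately show ?thesis using U that by blast
qed

text \<open>This is the fundamental theorem of calculus for the gauge integral. At tags in
  \<open>N\<close> the gauge forces the intervals into an open set of small measure, where absolute
  continuity makes the increments small; at all other tags the straddle estimate applies. Setting
  the integrand to 0 on \<open>N\<close> removes the tags of the first kind from the Riemann
  sum.\<close>

lemma abs_continuous_on_has_integral:
  assumes "p \<le> q" and ac: "abs_continuous_on p q f"
    and N: "N \<in> null_sets lebesgue"
    and D: "\<And>t. t \<in> {p..q} - N \<Longrightarrow> (f has_real_derivative f' t) (at t)"
  shows "((\<lambda>t. if t \<in> N then 0 else f' t) has_integral f q - f p) {p..q}" (is "(?g has_integral _) _")
  unfolding has_integral_real
proof (intro allI impI)
  fix e :: real assume "e > 0"
  \<comment> \<open>The \<open>+ 1\<close> keeps the denominator positive for \<open>p = q\<close>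
    and makes the straddle errors add up to strictly less than \<open>e / 2\<close>.\<close>
  define \<epsilon> where "\<epsilon> = e / (2 * (q - p + 1))"
  have \<epsilon>: "\<epsilon> > 0" "\<epsilon> * (q - p) < e / 2" using \<open>e > 0\<close> \<open>p \<le> q\<close> by (auto simp: \<epsilon>_def field_simps)
  have "e / 2 > 0" using \<open>e > 0\<close> by simp
  from abs_continuous_on_finite_family[OF ac this, where ?'x = "real \<times> real set"]
  obtain \<delta> where "\<delta> > 0" and \<delta>: "\<forall>(S :: (real \<times> real set) set) u v. finite S \<longrightarrow>
      (\<forall>i\<in>S. p \<le> u i \<and> u i \<le> v i \<and> v i \<le> q) \<longrightarrow>
      disjoint_family_on (\<lambda>i. {u i<..<v i}) S \<longrightarrow> (\<Sum>i\<in>S. v i - u i) < \<delta> \<longrightarrow>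
      (\<Sum>i\<in>S. \<bar>f (v i) - f (u i)\<bar>) < e / 2"
    by (elim exE conjE)
  obtain U where U: "open U" "N \<subseteq> U" "U \<in> lmeasurable" "measure lebesgue U < \<delta>"
    using null_set_outer_open[OF N \<open>\<delta> > 0\<close>] by metis
  have "\<exists>r>0. (t \<in> N \<longrightarrow> ball t r \<subseteq> U) \<and> (t \<in> {p..q} - N \<longrightarrow>
      (\<forall>u v. u \<le> t \<longrightarrow> t \<le> v \<longrightarrow> u \<in> ball t r \<longrightarrow> v \<in> ball t r \<longrightarrow>
        \<bar>(v - u) * f' t - (f v - f u)\<bar> \<le> \<epsilon> * (v - u)))" for t
  proof (cases "t \<in> N")
    case True
    then show ?thesis using U openE by (metis DiffE subsetD)
  next
    case False
    show ?thesis
    proof (cases "t \<in> {p..q}")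
      case True
      then show ?thesis using DERIV_straddle[OF D \<epsilon>(1), of t] False by (metis DiffI)
    next
      case False
      with \<open>t \<notin> N\<close> show ?thesis by (intro exI[of _ 1]) (simp del: atLeastAtMost_iff)
    qed
  qed
  then obtain r where r: "\<And>t. r t > 0" "\<And>t. t \<in> N \<Longrightarrow> ball t (r t) \<subseteq> U"
    "\<And>t u v. t \<in> {p..q} - N \<Longrightarrow> u \<le> t \<Longrightarrow> t \<le> v \<Longrightarrow> u \<in> ball t (r t) \<Longrightarrow> v \<in> ball t (r t) \<Longrightarrow>
        \<bar>(v - u) * f' t - (f v - f u)\<bar> \<le> \<epsilon> * (v - u)"
    by metis
  define \<gamma> where "\<gamma> = (\<lambda>t. ball t (r t))"
  have "gauge \<gamma>" using r(1) by (auto simp: gauge_def \<gamma>_def)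
  have close: "norm ((\<Sum>(x, K)\<in>P. measure lborel K *\<^sub>R ?g x) - (f q - f p)) < e"
    if P: "P tagged_division_of {p..q}" "\<gamma> fine P" for P
  proof -
    have fin: "finite P" using P(1) by blast
    define u v where "u = (\<lambda>i::real \<times> real set. Inf (snd i))" and "v = (\<lambda>i::real \<times> real set. Sup (snd i))"
    have K: "snd i = {u i..v i} \<and> u i \<le> fst i \<and> fst i \<le> v i \<and> p \<le> u i \<and> v i \<le> q \<and> snd i \<subseteq> ball (fst i) (r (fst i))"
      if i: "i \<in> P" for i
    proof -
      obtain x K where xK: "i = (x, K)" by (cases i)
      obtain c d where cd: "K = cbox c d" using tagged_division_ofD(4)[OF P(1)] i xK by metis
      have "x \<in> K" "K \<subseteq> {p..q}" using tagged_division_ofD(2,3)[OF P(1)] i xK by auto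
      moreover have "K \<subseteq> ball x (r x)" using P(2) i xK by (auto simp: fine_def \<gamma>_def)
      ultimately show ?thesis using xK cd by (auto simp: u_def v_def)
    qed
    have KB: "snd i \<subseteq> ball (fst i) (r (fst i))" if "i \<in> P" for i
      using K[OF that] by (elim conjE) assumption
    have KI: "snd i = {u i..v i}" if "i \<in> P" for i
      using K[OF that] by (elim conjE) assumption
    have tag: "u i \<le> fst i" "fst i \<le> v i" if "i \<in> P" for i
      using K[OF that] by linarith+
    have uv: "p \<le> u i \<and> u i \<le> v i \<and> v i \<le> q" if "i \<in> P" for i
      using K[OF that] by linarith
    have cont: "measure lborel (snd i) = v i - u i" if "i \<in> P" for i
      using uv[OF that] by (simp add: KI[OF that])
    have disj: "disjoint_family_on (\<lambda>i. {u i<..<v i}) P"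
      unfolding disjoint_family_on_def
    proof (intro ballI impI)
      fix i j assume ij: "i \<in> P" "j \<in> P" "i \<noteq> j"
      have "interior (snd i) \<inter> interior (snd j) = {}"
        using tagged_division_ofD(5)[OF P(1), of "fst i" "snd i" "fst j" "snd j"] ij by (auto simp: prod_eq_iff)
      then show "{u i<..<v i} \<inter> {u j<..<v j} = {}"
        unfolding KI[OF ij(1)] KI[OF ij(2)] interior_atLeastAtMost_real .
    qed
    define A where "A = {i \<in> P. fst i \<in> N}"
    have A: "A \<subseteq> P" "finite A" using fin by (auto simp: A_def)
    have disjA: "disjoint_family_on (\<lambda>i. {u i<..<v i}) A"
      using disj A by (meson disjoint_family_on_mono)
    have fm: "emeasure lebesgue {c<..<d} \<noteq> \<infinity>" for c d :: real
    proof -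
      have "bounded {c<..<d}" by (rule bounded_subset[OF bounded_closed_interval[of c d]]) auto
      then show ?thesis using emeasure_bounded_finite[of "{c<..<d}"] by auto
    qed
    \<comment> \<open>The intervals tagged in \<open>N\<close> do not overlap and lie in
      \<open>U\<close>, so their total length is below \<delta> and absolute continuity bounds their
      increments.\<close>
    have "(\<Sum>i\<in>A. v i - u i) = (\<Sum>i\<in>A. measure lebesgue {u i<..<v i})"
    proof (rule sum.cong[OF refl])
      fix i assume "i \<in> A"
      then have "u i \<le> v i" using uv[of i] A by auto
      then show "v i - u i = measure lebesgue {u i<..<v i}" by simp
    qed
    also have "\<dots> = measure lebesgue (\<Union>i\<in>A. {u i<..<v i})"
      using A disjA by (intro measure_finite_Union[symmetric]) (use fm in auto)
    also have "\<dots> \<le> measure lebesgue U"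
    proof (rule measure_mono_fmeasurable)
      show "(\<Union>i\<in>A. {u i<..<v i}) \<subseteq> U"
      proof (rule UN_least)
        fix i assume "i \<in> A"
        then have i: "i \<in> P" "fst i \<in> N" by (auto simp: A_def)
        have "{u i<..<v i} \<subseteq> snd i" unfolding KI[OF i(1)] by auto
        also have "\<dots> \<subseteq> ball (fst i) (r (fst i))" by (rule KB[OF i(1)])
        also have "\<dots> \<subseteq> U" by (rule r(2)[OF i(2)])
        finally show "{u i<..<v i} \<subseteq> U" .
      qed
    qed (use U A in auto)
    also have "\<dots> < \<delta>" by fact
    finally have sA: "(\<Sum>i\<in>A. \<bar>f (v i) - f (u i)\<bar>) < e / 2"
      using A(1) uv by (intro \<delta>[rule_format, OF A(2) _ disjA]) blast
    have sB: "\<bar>\<Sum>i\<in>P - A. (v i - u i) * f' (fst i) - (f (v i) - f (u i))\<bar> \<le> \<epsilon> * (q - p)"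
    proof -
      have "\<bar>\<Sum>i\<in>P - A. (v i - u i) * f' (fst i) - (f (v i) - f (u i))\<bar> \<le>
          (\<Sum>i\<in>P - A. \<epsilon> * (v i - u i))"
      proof (intro order_trans[OF sum_abs] sum_mono)
        fix i assume i: "i \<in> P - A"
        then have iP: "i \<in> P" by simp
        have k: "fst i \<in> {p..q} - N" "u i \<in> snd i" "v i \<in> snd i"
          using i uv[OF iP] tag[OF iP] unfolding KI[OF iP] by (auto simp: A_def)
        show "\<bar>(v i - u i) * f' (fst i) - (f (v i) - f (u i))\<bar> \<le> \<epsilon> * (v i - u i)"
        proof (rule r(3)[OF k(1)])
          have *: "snd i \<subseteq> ball (fst i) (r (fst i))" by (rule KB[OF iP])
          show "u i \<in> ball (fst i) (r (fst i))" by (rule subsetD[OF * k(2)])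
          show "v i \<in> ball (fst i) (r (fst i))" by (rule subsetD[OF * k(3)])
          show "u i \<le> fst i" "fst i \<le> v i" by (rule tag[OF iP])+
        qed
      qed
      also have "\<dots> \<le> (\<Sum>i\<in>P. \<epsilon> * (v i - u i))"
      proof (rule sum_mono2[OF fin])
        fix i assume "i \<in> P - (P - A)"
        then show "0 \<le> \<epsilon> * (v i - u i)" using uv[of i] \<epsilon>(1) by simp
      qed auto
      also have "\<dots> = \<epsilon> * (\<Sum>i\<in>P. v i - u i)" by (simp add: sum_distrib_left)
      also have "(\<Sum>i\<in>P. v i - u i) = q - p"
        using additive_tagged_division_1[OF \<open>p \<le> q\<close> P(1), of "\<lambda>x. x"] by (simp add: u_def v_def case_prod_unfold)
      finally show ?thesis .
    qed
    have "f q - f p = (\<Sum>i\<in>P. f (v i) - f (u i))"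
      using additive_tagged_division_1[OF \<open>p \<le> q\<close> P(1), of f] by (simp add: u_def v_def case_prod_unfold)
    then have "(\<Sum>(x, K)\<in>P. measure lborel K *\<^sub>R ?g x) - (f q - f p)
        = (\<Sum>i\<in>P. (v i - u i) * ?g (fst i) - (f (v i) - f (u i)))"
      using cont by (simp add: sum_subtractf case_prod_unfold)
    also have "\<dots> = (\<Sum>i\<in>P - A. (v i - u i) * ?g (fst i) - (f (v i) - f (u i))) +
        (\<Sum>i\<in>A. (v i - u i) * ?g (fst i) - (f (v i) - f (u i)))"
      by (rule sum.subset_diff) (use A fin in auto)
    also have "(\<Sum>i\<in>P - A. (v i - u i) * ?g (fst i) - (f (v i) - f (u i))) =
        (\<Sum>i\<in>P - A. (v i - u i) * f' (fst i) - (f (v i) - f (u i)))"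
      by (rule sum.cong) (auto simp: A_def)
    also have "(\<Sum>i\<in>A. (v i - u i) * ?g (fst i) - (f (v i) - f (u i))) = (\<Sum>i\<in>A. - (f (v i) - f (u i)))"
      by (rule sum.cong) (auto simp: A_def)
    finally have "\<bar>(\<Sum>(x, K)\<in>P. measure lborel K *\<^sub>R ?g x) - (f q - f p)\<bar> \<le>
       \<bar>\<Sum>i\<in>P - A. (v i - u i) * f' (fst i) - (f (v i) - f (u i))\<bar> + \<bar>\<Sum>i\<in>A. - (f (v i) - f (u i))\<bar>"
      by linarith
    also have "\<bar>\<Sum>i\<in>A. - (f (v i) - f (u i))\<bar> \<le> (\<Sum>i\<in>A. \<bar>f (v i) - f (u i)\<bar>)"
      by (rule order_trans[OF sum_abs]) (simp add: abs_minus_commute)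
    finally show ?thesis using sA sB \<epsilon> by (simp add: real_norm_def)
  qed
  show "\<exists>\<gamma>. gauge \<gamma> \<and> (\<forall>D. D tagged_division_of {p..q} \<and> \<gamma> fine D \<longrightarrow>
      norm ((\<Sum>(x, k)\<in>D. measure lborel k *\<^sub>R ?g x) - (f q - f p)) < e)"
    by (intro exI[of _ \<gamma>] conjI allI impI \<open>gauge \<gamma>\<close> close) (erule conjunct1 conjunct2)+
qed

text \<open>Setting \<open>deriv f\<close> and \<open>G\<close> to 0 on one exceptional null set
  leaves their integrals at \<open>f q - f p\<close> and \<open>J\<close> and makes the inequality
  pointwise.\<close>

lemma abs_continuous_on_increment_le:
  assumes "p \<le> q" "abs_continuous_on p q f"
    and ae: "AE t in lebesgue_on {p..q}. f differentiable (at t) \<and> deriv f t \<le> G t"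
    and G: "(G has_integral J) {p..q}"
  shows "f q - f p \<le> J"
proof -
  have "AE t in lebesgue. t \<in> {p..q} \<longrightarrow> f differentiable (at t) \<and> deriv f t \<le> G t"
    using ae by (subst (asm) AE_restrict_space_iff) auto
  then obtain N where N: "N \<in> null_sets lebesgue"
      "{t. \<not> (t \<in> {p..q} \<longrightarrow> f differentiable (at t) \<and> deriv f t \<le> G t)} \<subseteq> N"
    by (auto simp: eventually_ae_filter)
  have "((\<lambda>t. if t \<in> N then 0 else deriv f t) has_integral f q - f p) {p..q}"
  proof (rule abs_continuous_on_has_integral[OF assms(1,2) N(1)])
    fix t assume "t \<in> {p..q} - N"
    then have "f differentiable (at t)" using N(2) by blast
    then show "(f has_real_derivative deriv f t) (at t)"
      by (simp add: DERIV_deriv_iff_real_differentiable)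
  qed
  moreover have "((\<lambda>t. if t \<in> N then 0 else G t) has_integral J) {p..q}"
    by (rule has_integral_spike[OF _ _ G, of N]) (use N in \<open>auto simp: negligible_iff_null_sets\<close>)
  ultimately show ?thesis
    by (rule has_integral_le) (use N(2) in auto)
qed

lemma lipschitz_imp_abs_continuous_on:
  assumes "\<And>s t. p \<le> s \<Longrightarrow> s \<le> t \<Longrightarrow> t \<le> q \<Longrightarrow> \<bar>f t - f s\<bar> \<le> L * (t - s)"
  shows "abs_continuous_on p q f"
  unfolding abs_continuous_on_def
proof (intro allI impI)
  fix \<epsilon> :: real assume "\<epsilon> > 0"
  \<comment> \<open>Taking \<open>\<bar>L\<bar> + 1\<close> instead of \<open>L\<close> keeps the
    quotient positive for every \<open>L\<close>.\<close>
  define \<delta> where "\<delta> = \<epsilon> / (\<bar>L\<bar> + 1)"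
  have "\<delta> > 0" "(\<bar>L\<bar> + 1) * \<delta> = \<epsilon>" using \<open>\<epsilon> > 0\<close> by (auto simp: \<delta>_def)
  moreover have "(\<Sum>i<n. \<bar>f (v i) - f (u i)\<bar>) < \<epsilon>"
    if "\<forall>i<n. p \<le> u i \<and> u i < v i \<and> v i \<le> q" "(\<Sum>i<n. v i - u i) < \<delta>" for n :: nat and u v
  proof -
    have "(\<Sum>i<n. \<bar>f (v i) - f (u i)\<bar>) \<le> (\<Sum>i<n. (\<bar>L\<bar> + 1) * (v i - u i))"
    proof (rule sum_mono)
      fix i assume "i \<in> {..<n}"
      then have i: "p \<le> u i" "u i < v i" "v i \<le> q" using that by auto
      then have "\<bar>f (v i) - f (u i)\<bar> \<le> L * (v i - u i)" using assms by auto
      also have "\<dots> \<le> (\<bar>L\<bar> + 1) * (v i - u i)" using i by (intro mult_right_mono) auto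
      finally show "\<bar>f (v i) - f (u i)\<bar> \<le> (\<bar>L\<bar> + 1) * (v i - u i)" .
    qed
    also have "\<dots> = (\<bar>L\<bar> + 1) * (\<Sum>i<n. v i - u i)" by (simp add: sum_distrib_left)
    also have "\<dots> < (\<bar>L\<bar> + 1) * \<delta>" using that by (intro mult_strict_left_mono) auto
    finally show ?thesis using \<open>(\<bar>L\<bar> + 1) * \<delta> = \<epsilon>\<close> by simp
  qed
  ultimately show "\<exists>\<delta>>0. \<forall>(n::nat) u v.
      (\<forall>i<n. p \<le> u i \<and> u i < v i \<and> v i \<le> q) \<and>
      disjoint_family_on (\<lambda>i. {u i<..<v i}) {..<n} \<and>
      (\<Sum>i<n. v i - u i) < \<delta> \<longrightarrow>
      (\<Sum>i<n. \<bar>f (v i) - f (u i)\<bar>) < \<epsilon>" by blast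
qed

section \<open>A comparison principle for delay inequalities\<close>

text \<open>The interval is crossed in finitely many steps of length at most \<open>d\<close>; the
  induction runs over their number.\<close>

lemma locally_nondecreasing_imp_le:
  fixes w :: "real \<Rightarrow> real"
  assumes "d > 0" and loc: "\<And>s t. p \<le> s \<Longrightarrow> s \<le> t \<Longrightarrow> t \<le> q \<Longrightarrow> t - s \<le> d \<Longrightarrow> w s \<le> w t"
    and "p \<le> q"
  shows "w p \<le> w q"
proof -
  have *: "w p \<le> w t" if "p \<le> t" "t \<le> q" "t - p \<le> real n * d" for n t
    using that
  proof (induction n arbitrary: t)
    case 0
    then show ?case by (simp add: order_antisym)
  next
    case (Suc n)
    define s where "s = max p (t - d)"
    have "w p \<le> w s" using Suc.prems \<open>d > 0\<close> by (intro Suc.IH) (auto simp: s_def algebra_simps max_def)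
    also have "w s \<le> w t" using Suc.prems \<open>d > 0\<close> by (intro loc) (auto simp: s_def)
    finally show ?case .
  qed
  obtain n where "(q - p) / d \<le> real n" using real_arch_simple by blast
  then show ?thesis using \<open>d > 0\<close> \<open>p \<le> q\<close> by (intro *[where n = n]) (auto simp: field_simps)
qed

text \<open>For \<open>I\<close> the integral of \<open>q\<close>, the hypothesis is the integrated form of
  \<open>u' \<ge> - c Z exp (- c I) q\<close>. The increments are compared directly, so that the a.e. derivative
  of \<open>I\<close> (Lebesgue's differentiation theorem) is not needed.\<close>

lemma exp_integral_lower_bound:
  fixes u I :: "real \<Rightarrow> real"
  assumes "p \<le> q" and cont: "continuous_on {p..q} I"
    and mono: "\<And>s t. p \<le> s \<Longrightarrow> s \<le> t \<Longrightarrow> t \<le> q \<Longrightarrow> I s \<le> I t"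
    and "Z \<ge> 0" "c > 0"
    and step: "\<And>s t. p \<le> s \<Longrightarrow> s \<le> t \<Longrightarrow> t \<le> q \<Longrightarrow>
       u t - u s \<ge> - (c * Z * exp (- c * I s)) * (I t - I s)"
  shows "u q - u p \<ge> Z * (exp (- c * I q) - exp (- c * I p))"
proof -
  \<comment> \<open>The factor \<kappa> > 1 pays for freezing \<open>exp (- c * I)\<close> at the
    left end of a short interval; at the end \<kappa> tends to 1.\<close>
  have *: "u q - \<kappa> * Z * exp (- c * I q) \<ge> u p - \<kappa> * Z * exp (- c * I p)" if "\<kappa> > 1" for \<kappa>
  proof -
    have "ln \<kappa> / c > 0" using that \<open>c > 0\<close> by simp
    moreover have "uniformly_continuous_on {p..q} I"
      using cont by (simp add: compact_uniformly_continuous)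
    ultimately obtain d where "d > 0"
      and d: "\<And>s t. s \<in> {p..q} \<Longrightarrow> t \<in> {p..q} \<Longrightarrow> dist t s < d \<Longrightarrow> dist (I t) (I s) < ln \<kappa> / c"
      unfolding uniformly_continuous_on_def by metis
    show ?thesis
    proof (rule locally_nondecreasing_imp_le[where d = "d / 2" and w = "\<lambda>t. u t - \<kappa> * Z * exp (- c * I t)"])
      fix s t assume st: "p \<le> s" "s \<le> t" "t \<le> q" "t - s \<le> d / 2"
      define \<Delta> where "\<Delta> = c * (I t - I s)"
      have "\<bar>I t - I s\<bar> < ln \<kappa> / c" using d[of s t] st \<open>d > 0\<close> by (auto simp: dist_real_def)
      then have "\<Delta> \<le> ln \<kappa>" using \<open>c > 0\<close> by (simp add: \<Delta>_def field_simps abs_less_iff)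
      then have e\<Delta>: "exp \<Delta> \<le> \<kappa>" using that by (metis exp_le_cancel_iff exp_ln less_trans zero_less_one)
      have "\<Delta> \<ge> 0" using mono st \<open>c > 0\<close> by (simp add: \<Delta>_def)
      have "\<Delta> \<le> exp \<Delta> - 1" using exp_ge_add_one_self[of \<Delta>] by linarith
      then have "exp \<Delta> * \<Delta> \<le> \<kappa> * (exp \<Delta> - 1)"
        using e\<Delta> \<open>\<Delta> \<ge> 0\<close> that by (intro mult_mono) auto
      then have "(exp \<Delta> * \<Delta>) * (Z * exp (- c * I t)) \<le> (\<kappa> * (exp \<Delta> - 1)) * (Z * exp (- c * I t))"
        using \<open>Z \<ge> 0\<close> by (intro mult_right_mono) auto
      moreover have "exp (- c * I s) = exp \<Delta> * exp (- c * I t)"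
        by (simp add: \<Delta>_def exp_add[symmetric] algebra_simps)
      moreover have "u t - u s \<ge> - (c * Z * exp (- c * I s)) * (I t - I s)" using st by (intro step)
      ultimately show "u s - \<kappa> * Z * exp (- c * I s) \<le> u t - \<kappa> * Z * exp (- c * I t)"
        unfolding \<Delta>_def by (simp add: algebra_simps)
    qed (use \<open>d > 0\<close> \<open>p \<le> q\<close> in auto)
  qed
  define X where "X = Z * (exp (- c * I p) - exp (- c * I q))"
  have "u p - u q \<le> \<kappa> * X" if "\<kappa> > 1" for \<kappa>
    using *[OF that] by (simp add: X_def algebra_simps)
  moreover have "((\<lambda>\<kappa>. \<kappa> * X) \<longlongrightarrow> 1 * X) (at_right 1)"
    by (intro tendsto_intros)
  ultimately have "u p - u q \<le> 1 * X"
    by (intro tendsto_lowerbound[where F = "at_right 1" and f = "\<lambda>\<kappa>. \<kappa> * X"])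
      (auto simp: eventually_at_right_field intro!: exI[of _ 2])
  then show ?thesis by (simp add: X_def algebra_simps)
qed

text \<open>With \<open>I\<close> the integral of \<open>\<Sum> c\<^sub>k\<close>, the last hypothesis encodes \<open>u' \<ge> - \<Sum> c\<^sub>k u(\<eta>\<^sub>k)\<close>, where \<open>u\<close> is
  frozen at \<open>u p\<close> before \<open>p\<close> and \<open>I\<close> increases by at most \<open>1/e\<close> over each delay. At the maximum
  of \<open>z = u exp (e I)\<close> the inequality shows that \<open>z\<close> cannot decrease afterwards.\<close>

lemma delay_inequality_nonneg:
  fixes u I :: "real \<Rightarrow> real"
  assumes contI: "continuous_on {p..q} I" and contu: "continuous_on {p..q} u"
    and mono: "\<And>s t. p \<le> s \<Longrightarrow> s \<le> t \<Longrightarrow> t \<le> q \<Longrightarrow> I s \<le> I t"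
    and "u p \<ge> 0"
    and step: "\<And>s t M. p \<le> s \<Longrightarrow> s \<le> t \<Longrightarrow> t \<le> q \<Longrightarrow>
       (\<And>r w. s \<le> r \<Longrightarrow> r \<le> t \<Longrightarrow> p \<le> w \<Longrightarrow> w \<le> r \<Longrightarrow> I r - I w \<le> 1 / exp 1 \<Longrightarrow> u w \<le> M) \<Longrightarrow>
       u t - u s \<ge> - M * (I t - I s)"
    and t: "t \<in> {p..q}"
  shows "u t \<ge> 0"
proof -
  \<comment> \<open>This value solves \<open>c = exp (c / e)\<close>, the characteristic equation in
    the critical case where \<open>I\<close> grows by exactly \<open>1/e\<close> over a
    delay.\<close>
  define c :: real where "c = exp 1"
  have "c > 0" by (simp add: c_def)
  define z where "z = (\<lambda>t. u t * exp (c * I t))"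
  have contz: "continuous_on {p..q} z" unfolding z_def by (intro continuous_intros contI contu)
  have cmp: "compact {p..t}" "{p..t} \<noteq> {}" using t by auto
  have "continuous_on {p..t} z" using contz t by (auto intro: continuous_on_subset)
  then obtain r where r: "r \<in> {p..t}" "\<And>w. w \<in> {p..t} \<Longrightarrow> z w \<le> z r"
    using continuous_attains_sup[OF cmp] by blast
  have "z r \<ge> 0" using r(2)[of p] t \<open>u p \<ge> 0\<close> by (force simp: z_def intro: order_trans[rotated])
  have "u t - u r \<ge> z r * (exp (- c * I t) - exp (- c * I r))"
  proof (rule exp_integral_lower_bound)
    fix s t' assume st: "r \<le> s" "s \<le> t'" "t' \<le> t"
    \<comment> \<open>The maximum property gives \<open>u w \<le> z r * exp (- c * I w)\<close>, and
      a gain of at most \<open>1/e\<close> in \<open>I\<close> costs at most the factor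
      \<open>exp 1 = c\<close>.\<close>
    show "- (c * z r * exp (- c * I s)) * (I t' - I s) \<le> u t' - u s"
    proof (rule step)
      fix r' w assume w: "s \<le> r'" "r' \<le> t'" "p \<le> w" "w \<le> r'" "I r' - I w \<le> 1 / exp 1"
      have "c * I s \<le> c * I r'" using w st r t \<open>c > 0\<close> by (intro mult_left_mono mono) auto
      moreover have "c * (I r' - I w) \<le> 1" using mult_left_mono[OF w(5), of c] by (simp add: c_def)
      ultimately have "exp (- c * I w) \<le> exp (1 - c * I s)" by (simp add: algebra_simps)
      have "u w = z w * exp (- c * I w)" by (simp add: z_def exp_minus)
      also have "\<dots> \<le> z r * exp (- c * I w)" using w st r by (intro mult_right_mono) auto
      also have "\<dots> \<le> z r * exp (1 - c * I s)" by (intro mult_left_mono) fact+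
      also have "\<dots> = c * z r * exp (- c * I s)" by (simp add: c_def exp_diff exp_minus field_simps)
      finally show "u w \<le> c * z r * exp (- c * I s)" .
    qed (use st r t in auto)
  qed (use r t contI mono \<open>z r \<ge> 0\<close> \<open>c > 0\<close> in \<open>auto intro: continuous_on_subset\<close>)
  moreover have "u r = z r * exp (- c * I r)" by (simp add: z_def exp_minus)
  ultimately have "u t \<ge> z r * exp (- c * I t)" by (simp add: algebra_simps)
  then show ?thesis using \<open>z r \<ge> 0\<close> by (meson exp_ge_zero mult_nonneg_nonneg order_trans)
qed

text \<open>The infimum of the admissible bounds is itself a bound, since the countably many
  exceptional sets for \<open>Inf S + 1 / real (Suc n)\<close> unite to a null set. Minimality turns
  a bound on \<open>w\<close> expressed through \<open>W\<close> into an inequality for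
  \<open>W\<close>.\<close>

lemma least_AE_bound:
  fixes w :: "'a \<Rightarrow> real"
  assumes "AE x in M. w x \<le> C"
  obtains W where "W \<ge> 0" "AE x in M. w x \<le> W" "\<And>C. C \<ge> 0 \<Longrightarrow> AE x in M. w x \<le> C \<Longrightarrow> W \<le> C"
proof -
  define S where "S = {C. C \<ge> 0 \<and> (AE x in M. w x \<le> C)}"
  have "max 0 C \<in> S" using assms by (auto simp: S_def elim: eventually_mono)
  then have ne: "S \<noteq> {}" by auto
  have bdd: "bdd_below S" by (rule bdd_belowI[of _ 0]) (auto simp: S_def)
  have "AE x in M. w x \<le> Inf S + 1 / real (Suc n)" for n
  proof -
    obtain C' where "C' \<in> S" "C' < Inf S + 1 / real (Suc n)"
      using cInf_lessD[OF ne, of "Inf S + 1 / real (Suc n)"] by auto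
    then show ?thesis by (auto simp: S_def elim: eventually_mono)
  qed
  then have "AE x in M. \<forall>n. w x \<le> Inf S + 1 / real (Suc n)" by (simp add: AE_all_countable)
  then have "AE x in M. w x \<le> Inf S"
  proof eventually_elim
    case (elim x)
    have "(\<lambda>n. Inf S + 1 / real (Suc n)) \<longlonglongrightarrow> Inf S + 0"
      by (intro tendsto_intros LIMSEQ_Suc lim_1_over_n)
    then show ?case using elim by (intro LIMSEQ_le_const) auto
  qed
  moreover have "Inf S \<ge> 0" using ne by (intro cInf_greatest) (auto simp: S_def)
  moreover have "Inf S \<le> C'" if "C' \<ge> 0" "AE x in M. w x \<le> C'" for C'
    using that by (intro cInf_lower[OF _ bdd]) (simp add: S_def)
  ultimately show ?thesis using that by blast
qed

section \<open>A priori estimates for solutions\<close>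

lemma AE_lebesgue_on_iff:
  "S \<in> sets lebesgue \<Longrightarrow> (AE t in lebesgue_on S. P t) \<longleftrightarrow> (AE t in lebesgue. t \<in> S \<longrightarrow> P t)"
  by (subst AE_restrict_space_iff) auto

lemma AE_lebesgue_on_mono:
  assumes "AE t in lebesgue_on S. P t" "S' \<subseteq> S" "S \<in> sets lebesgue" "S' \<in> sets lebesgue"
  shows "AE t in lebesgue_on S'. P t"
  using assms by (auto simp: AE_lebesgue_on_iff elim: eventually_mono)

lemma abs_continuous_on_subinterval:
  assumes "abs_continuous_on p q f" "p \<le> p'" "q' \<le> q"
  shows "abs_continuous_on p' q' f"
  unfolding abs_continuous_on_def
proof (intro allI impI)
  fix \<epsilon> :: real assume "\<epsilon> > 0"
  obtain \<delta> where \<delta>: "\<delta> > 0" "\<And>(n::nat) u v.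
      (\<forall>i<n. p \<le> u i \<and> u i < v i \<and> v i \<le> q) \<and>
      disjoint_family_on (\<lambda>i. {u i<..<v i}) {..<n} \<and> (\<Sum>i<n. v i - u i) < \<delta> \<Longrightarrow>
      (\<Sum>i<n. \<bar>f (v i) - f (u i)\<bar>) < \<epsilon>"
    using assms(1)[unfolded abs_continuous_on_def, rule_format, OF \<open>\<epsilon> > 0\<close>] by blast
  show "\<exists>\<delta>>0. \<forall>(n::nat) u v.
      (\<forall>i<n. p' \<le> u i \<and> u i < v i \<and> v i \<le> q') \<and>
      disjoint_family_on (\<lambda>i. {u i<..<v i}) {..<n} \<and> (\<Sum>i<n. v i - u i) < \<delta> \<longrightarrow>
      (\<Sum>i<n. \<bar>f (v i) - f (u i)\<bar>) < \<epsilon>"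
  proof (intro exI[of _ \<delta>] conjI allI impI \<delta>)
    fix n :: nat and u v and i
    assume *: "(\<forall>i<n. p' \<le> u i \<and> u i < v i \<and> v i \<le> q') \<and>
      disjoint_family_on (\<lambda>i. {u i<..<v i}) {..<n} \<and> (\<Sum>i<n. v i - u i) < \<delta>"
    then show "disjoint_family_on (\<lambda>i. {u i<..<v i}) {..<n}" "(\<Sum>i<n. v i - u i) < \<delta>" by blast+
    assume "i < n"
    with * have "p' \<le> u i \<and> u i < v i \<and> v i \<le> q'" by blast
    then show "p \<le> u i" "u i < v i" "v i \<le> q" using assms(2,3) by linarith+
  qed
qed

text \<open>The tangent of the convex function \<open>exp\<close> at \<open>a\<close> lies below its
  graph.\<close>

lemma exp_diff_le: "exp a - exp b \<le> exp a * (a - b)" for a b :: real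
proof -
  have "exp a * (1 + (b - a)) \<le> exp a * exp (b - a)"
    by (intro mult_left_mono exp_ge_add_one_self) auto
  then show ?thesis by (simp add: exp_diff algebra_simps)
qed

text \<open>On a bounded interval both factors are bounded and Lipschitz. The size of
  \<open>L'\<close> is immaterial: it only serves to make the weighted solution absolutely
  continuous.\<close>

lemma lipschitz_times_exp:
  fixes f :: "real \<Rightarrow> real"
  assumes lip: "\<And>s t. p \<le> s \<Longrightarrow> s \<le> t \<Longrightarrow> t \<le> q \<Longrightarrow> \<bar>f t - f s\<bar> \<le> L * (t - s)"
  obtains L' where "\<And>s t. p \<le> s \<Longrightarrow> s \<le> t \<Longrightarrow> t \<le> q \<Longrightarrow>
    \<bar>f t * exp (\<mu> * (t - \<sigma>)) - f s * exp (\<mu> * (s - \<sigma>))\<bar> \<le> L' * (t - s)"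
proof -
  define W where "W = exp (\<bar>\<mu>\<bar> * (\<bar>p\<bar> + \<bar>q\<bar> + \<bar>\<sigma>\<bar>))"
  define X where "X = \<bar>f p\<bar> + \<bar>L\<bar> * (q - p)"
  define \<omega> where "\<omega> = (\<lambda>t. exp (\<mu> * (t - \<sigma>)))"
  have W: "\<omega> t \<le> W" if "p \<le> t" "t \<le> q" for t
  proof -
    have "\<mu> * (t - \<sigma>) \<le> \<bar>\<mu>\<bar> * \<bar>t - \<sigma>\<bar>" by (metis abs_ge_self abs_mult)
    also have "\<dots> \<le> \<bar>\<mu>\<bar> * (\<bar>p\<bar> + \<bar>q\<bar> + \<bar>\<sigma>\<bar>)" using that by (intro mult_left_mono) auto
    finally show ?thesis by (simp add: W_def \<omega>_def)
  qed
  show ?thesis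
  proof (rule that)
    fix s t assume st: "p \<le> s" "s \<le> t" "t \<le> q"
    have "\<bar>f t - f p\<bar> \<le> L * (t - p)" using st by (intro lip) auto
    also have "\<dots> \<le> \<bar>L\<bar> * (q - p)" using st by (intro mult_mono) auto
    finally have X: "\<bar>f t\<bar> \<le> X" by (auto simp: X_def)
    have "\<omega> t - \<omega> s \<le> \<omega> t * (\<mu> * (t - s))" "\<omega> s - \<omega> t \<le> \<omega> s * (- \<mu> * (t - s))"
      using exp_diff_le[of "\<mu> * (t - \<sigma>)" "\<mu> * (s - \<sigma>)"] exp_diff_le[of "\<mu> * (s - \<sigma>)" "\<mu> * (t - \<sigma>)"]
      by (simp_all add: \<omega>_def algebra_simps)
    moreover have "\<omega> r * (\<nu> * (t - s)) \<le> W * (\<bar>\<mu>\<bar> * (t - s))" if "p \<le> r" "r \<le> q" "\<bar>\<nu>\<bar> = \<bar>\<mu>\<bar>" for r \<nu>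
    proof -
      have "\<omega> r * (\<nu> * (t - s)) \<le> \<omega> r * (\<bar>\<mu>\<bar> * (t - s))"
        using st that(3) by (intro mult_left_mono mult_right_mono) (auto simp: \<omega>_def)
      also have "\<dots> \<le> W * (\<bar>\<mu>\<bar> * (t - s))"
        using st W[OF that(1,2)] by (intro mult_right_mono) auto
      finally show ?thesis .
    qed
    note this[of t \<mu>] this[of s "- \<mu>"]
    ultimately have \<omega>: "\<bar>\<omega> t - \<omega> s\<bar> \<le> W * (\<bar>\<mu>\<bar> * (t - s))" using st by (simp add: abs_le_iff)
    have "f t * \<omega> t - f s * \<omega> s = f t * (\<omega> t - \<omega> s) + (f t - f s) * \<omega> s" by (simp add: algebra_simps)
    also have "\<bar>\<dots>\<bar> \<le> \<bar>f t\<bar> * \<bar>\<omega> t - \<omega> s\<bar> + \<bar>f t - f s\<bar> * \<omega> s"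
      by (rule order_trans[OF abs_triangle_ineq]) (simp add: abs_mult \<omega>_def)
    also have "\<dots> \<le> X * (W * (\<bar>\<mu>\<bar> * (t - s))) + (L * (t - s)) * W"
    proof (intro add_mono mult_mono)
      show "0 \<le> X" "0 \<le> L * (t - s)" using X lip[of s t] st by linarith+
    qed (use st X \<omega> W[of s] lip[of s t] in \<open>simp_all add: \<omega>_def\<close>)
    finally show "\<bar>f t * exp (\<mu> * (t - \<sigma>)) - f s * exp (\<mu> * (s - \<sigma>))\<bar> \<le> (X * W * \<bar>\<mu>\<bar> + L * W) * (t - s)"
      by (simp add: \<omega>_def algebra_simps)
  qed
qed

text \<open>One \<open>D\<close> bounds the delays of \<open>g\<close> and of all
  \<open>h k\<close>. The preimage condition on \<open>g\<close> lets almost-everywhere statements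
  about \<open>deriv x\<close> be evaluated at \<open>g t\<close>.\<close>

locale neutral_delay =
  fixes t0 a1 B D :: real and m :: nat and a g :: "real \<Rightarrow> real" and b h :: "nat \<Rightarrow> real \<Rightarrow> real"
  assumes t0: "0 \<le> t0" and a1: "0 \<le> a1" "a1 < 1" and B: "0 \<le> B" and D: "0 < D"
    and a_le: "AE t in lebesgue_on {t0..}. \<bar>a t\<bar> \<le> a1"
    and b_nonneg: "\<And>k t. k \<in> {1..m} \<Longrightarrow> t0 \<le> t \<Longrightarrow> 0 \<le> b k t"
    and b_le: "AE t in lebesgue_on {t0..}. (\<Sum>k=1..m. b k t) \<le> B"
    and g: "\<And>t. t0 \<le> t \<Longrightarrow> g t \<le> t \<and> t - g t \<le> D"
    and h: "\<And>k t. k \<in> {1..m} \<Longrightarrow> t0 \<le> t \<Longrightarrow> h k t \<le> t \<and> t - h k t \<le> D"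
    and g_null: "\<And>E. E \<in> null_sets lebesgue \<Longrightarrow> {t. 0 \<le> t \<and> g t \<in> E} \<in> null_sets lebesgue"

begin

text \<open>With the weight \<open>exp (- growth * (t - \<sigma>))\<close>, \<open>Y \<le> K + Z / growth\<close>, and the rate is large enough to
  absorb \<open>B Z / growth\<close> into \<open>(1 - a1) Z / 2\<close>.\<close>

definition growth :: real where "growth = 2 * B / (1 - a1) + 1"

text \<open>The second factor bounds the weighted supremum over one delay length in units of
  \<open>K\<close>; the exponential undoes the weight.\<close>

definition initial_const :: real where
  "initial_const = exp (growth * D) * (1 + 2 * (a1 + 2 * B) / (1 - a1))"

lemma growth: "1 \<le> growth" "2 * B \<le> (1 - a1) * growth"
proof -
  have "(1 - a1) * growth = 2 * B + (1 - a1)" using a1 by (simp add: growth_def distrib_left)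
  then show "2 * B \<le> (1 - a1) * growth" using a1 by simp
  show "1 \<le> growth" using a1 B by (simp add: growth_def)
qed

end

locale neutral_delay_solution = neutral_delay +
  fixes \<sigma> K :: real and \<phi> \<psi> x :: "real \<Rightarrow> real"
  assumes \<sigma>: "t0 \<le> \<sigma>"
    and \<phi>: "\<And>s. s \<le> \<sigma> \<Longrightarrow> \<bar>\<phi> s\<bar> \<le> K"
    and \<psi>: "\<And>s. s < \<sigma> \<Longrightarrow> \<bar>\<psi> s\<bar> \<le> K"
    and sol: "neutral_solution m a g b h \<sigma> \<phi> \<psi> x"
begin

lemma K_nonneg: "0 \<le> K"
  using \<phi>[of \<sigma>] by simp

lemma x_start: "x \<sigma> = \<phi> \<sigma>"
  using sol by (simp add: neutral_solution_def)

lemma equation: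
  "AE t in lebesgue_on {\<sigma>..T}.
      deriv x t = a t * (if g t < \<sigma> then \<psi> (g t) else deriv x (g t))
        - (\<Sum>k=1..m. b k t * (if h k t \<le> \<sigma> then \<phi> (h k t) else x (h k t)))"
proof -
  have "AE t in lebesgue_on {\<sigma>..}.
      deriv x t - a t * (if g t < \<sigma> then \<psi> (g t) else deriv x (g t)) =
      - (\<Sum>k=1..m. b k t * (if h k t \<le> \<sigma> then \<phi> (h k t) else x (h k t)))"
    using sol by (simp add: neutral_solution_def)
  then have "AE t in lebesgue_on {\<sigma>..}.
      deriv x t = a t * (if g t < \<sigma> then \<psi> (g t) else deriv x (g t))
        - (\<Sum>k=1..m. b k t * (if h k t \<le> \<sigma> then \<phi> (h k t) else x (h k t)))"
    by eventually_elim simp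
  then show ?thesis by (rule AE_lebesgue_on_mono) auto
qed

lemma coefficient_bounds:
  "AE t in lebesgue_on {\<sigma>..T}. \<bar>a t\<bar> \<le> a1 \<and> (\<Sum>k=1..m. b k t) \<le> B"
proof (rule AE_lebesgue_on_mono[where S = "{t0..}"])
  show "AE t in lebesgue_on {t0..}. \<bar>a t\<bar> \<le> a1 \<and> (\<Sum>k=1..m. b k t) \<le> B"
    using a_le b_le by eventually_elim simp
qed (use \<sigma> in auto)

text \<open>The null set on which \<open>P\<close> fails has a null preimage under \<open>g\<close>,
  and \<open>g t \<le> t\<close> keeps \<open>g t\<close> to the left of \<open>T\<close>. This is
  how bounds on \<open>deriv x\<close> reach the neutral term.\<close>

lemma AE_delayed:
  assumes "AE s in lebesgue_on {\<sigma>..T}. P s"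
  shows "AE t in lebesgue_on {\<sigma>..T}. \<sigma> \<le> g t \<longrightarrow> P (g t)"
proof -
  obtain N where N: "N \<in> null_sets lebesgue" "{s. \<not> (s \<in> {\<sigma>..T} \<longrightarrow> P s)} \<subseteq> N"
  proof -
    have "AE s in lebesgue. s \<in> {\<sigma>..T} \<longrightarrow> P s" using assms by (subst (asm) AE_lebesgue_on_iff) auto
    then show ?thesis using that unfolding eventually_ae_filter by auto
  qed
  have "AE t in lebesgue. t \<notin> {t. 0 \<le> t \<and> g t \<in> N}"
    using g_null[OF N(1)] by (rule AE_not_in)
  then have "AE t in lebesgue. t \<in> {\<sigma>..T} \<longrightarrow> \<sigma> \<le> g t \<longrightarrow> P (g t)"
  proof eventually_elim
    case (elim t)
    show ?case
    proof (intro impI)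
      assume t: "t \<in> {\<sigma>..T}" "\<sigma> \<le> g t"
      then have "g t \<notin> N" using elim t0 \<sigma> by auto
      moreover have "g t \<le> t" using t \<sigma> g[of t] by auto
      ultimately show "P (g t)" using N(2) t by auto
    qed
  qed
  then show ?thesis by (simp add: AE_lebesgue_on_iff)
qed

lemma differentiable_bounded:
  obtains C where "AE t in lebesgue_on {\<sigma>..T}. x differentiable (at t) \<and> \<bar>deriv x t\<bar> \<le> C"
proof -
  have "\<forall>c>\<sigma>. \<exists>C. AE t in lebesgue_on {\<sigma>..c}. x differentiable (at t) \<and> \<bar>deriv x t\<bar> \<le> C"
    using sol unfolding neutral_solution_def by blast
  \<comment> \<open>The definition of a solution speaks only of right ends beyond \<sigma>; the
    enlarged right end covers every \<open>T\<close>.\<close>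
  then have "\<exists>C. AE t in lebesgue_on {\<sigma>..max T (\<sigma> + 1)}. x differentiable (at t) \<and> \<bar>deriv x t\<bar> \<le> C"
    by (simp add: less_max_iff_disj)
  then obtain C where "AE t in lebesgue_on {\<sigma>..max T (\<sigma> + 1)}. x differentiable (at t) \<and> \<bar>deriv x t\<bar> \<le> C" ..
  then have "AE t in lebesgue_on {\<sigma>..T}. x differentiable (at t) \<and> \<bar>deriv x t\<bar> \<le> C"
    by (rule AE_lebesgue_on_mono) auto
  then show ?thesis by (rule that)
qed

lemma abs_continuous: "\<sigma> \<le> s \<Longrightarrow> abs_continuous_on s t x"
proof -
  assume "\<sigma> \<le> s"
  have "\<forall>c>\<sigma>. abs_continuous_on \<sigma> c x" using sol unfolding neutral_solution_def by blast
  then have "abs_continuous_on \<sigma> (max t (\<sigma> + 1)) x" by (simp add: less_max_iff_disj)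
  then show ?thesis using \<open>\<sigma> \<le> s\<close> by (rule abs_continuous_on_subinterval) simp
qed

text \<open>The bounded derivative makes \<open>x\<close> Lipschitz, hence also its product with the
  weight, whose derivative is given by the product rule. The factor \<open>c\<close> is later taken
  as 1 and as -1, which turns one-sided estimates into estimates of absolute values.\<close>

lemma weighted_increment_le:
  assumes "\<sigma> \<le> s" "s \<le> t"
    and G: "(G has_integral J) {s..t}"
    and le: "AE r in lebesgue_on {s..t}.
      c * (deriv x r * exp (\<mu> * (r - \<sigma>)) + \<mu> * (x r * exp (\<mu> * (r - \<sigma>)))) \<le> G r"
  shows "c * (x t * exp (\<mu> * (t - \<sigma>)) - x s * exp (\<mu> * (s - \<sigma>))) \<le> J"
proof -
  obtain C where C: "AE r in lebesgue_on {s..t}. x differentiable (at r) \<and> \<bar>deriv x r\<bar> \<le> C"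
  proof -
    obtain C where "AE r in lebesgue_on {\<sigma>..t}. x differentiable (at r) \<and> \<bar>deriv x r\<bar> \<le> C"
      using differentiable_bounded by blast
    then have "AE r in lebesgue_on {s..t}. x differentiable (at r) \<and> \<bar>deriv x r\<bar> \<le> C"
      by (rule AE_lebesgue_on_mono) (use \<open>\<sigma> \<le> s\<close> in auto)
    then show ?thesis by (rule that)
  qed
  have lip: "\<bar>x r - x q\<bar> \<le> C * (r - q)" if qr: "s \<le> q" "q \<le> r" "r \<le> t" for q r
  proof -
    have ac: "abs_continuous_on q r (\<lambda>t. e * x t)" if e: "\<bar>e\<bar> = 1" for e
    proof -
      have "\<bar>e * x v - e * x u\<bar> = \<bar>x v - x u\<bar>" for u v
        using e by (metis abs_mult mult_1 right_diff_distrib)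
      then show ?thesis
        using abs_continuous[of q r] qr \<open>\<sigma> \<le> s\<close> by (simp add: abs_continuous_on_def)
    qed
    have C': "AE r in lebesgue_on {q..r}. x differentiable (at r) \<and> \<bar>deriv x r\<bar> \<le> C"
      using C by (rule AE_lebesgue_on_mono) (use qr in auto)
    have const: "((\<lambda>_. C) has_integral C * (r - q)) {q..r}"
      using has_integral_const_real[of C q r] qr by (simp add: mult.commute)
    have "e * x r - e * x q \<le> C * (r - q)" if e: "\<bar>e\<bar> = 1" for e
    proof (rule abs_continuous_on_increment_le[OF \<open>q \<le> r\<close> ac[OF e] _ const])
      show "AE t in lebesgue_on {q..r}. (\<lambda>t. e * x t) differentiable (at t) \<and> deriv (\<lambda>t. e * x t) t \<le> C"
        using C'
      proof eventually_elim
        case (elim t)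
        then have d: "x field_differentiable (at t)"
          by (simp add: field_differentiable_def real_differentiable_def)
        then have "deriv (\<lambda>t. e * x t) t = e * deriv x t" by (rule deriv_cmult)
        moreover have "e * deriv x t \<le> \<bar>deriv x t\<bar>" using e by (metis abs_ge_self abs_mult mult_1)
        ultimately show ?case using elim by auto
      qed
    qed
    from this[of 1] this[of "- 1"] show ?thesis by (simp add: abs_le_iff)
  qed
  define y where "y = (\<lambda>t. x t * exp (\<mu> * (t - \<sigma>)))"
  obtain L' where L': "\<And>q r. s \<le> q \<Longrightarrow> q \<le> r \<Longrightarrow> r \<le> t \<Longrightarrow> \<bar>y r - y q\<bar> \<le> L' * (r - q)"
    unfolding y_def using lipschitz_times_exp[of s t x C \<mu> \<sigma>] lip by blast
  have "abs_continuous_on s t (\<lambda>t. c * y t)"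
  proof (rule lipschitz_imp_abs_continuous_on)
    fix q r assume "s \<le> q" "q \<le> r" "r \<le> t"
    then have "\<bar>c\<bar> * \<bar>y r - y q\<bar> \<le> \<bar>c\<bar> * (L' * (r - q))" by (intro mult_left_mono L') auto
    then show "\<bar>c * y r - c * y q\<bar> \<le> \<bar>c\<bar> * L' * (r - q)"
      by (simp add: abs_mult[symmetric] right_diff_distrib mult.assoc)
  qed
  moreover have "AE r in lebesgue_on {s..t}. (\<lambda>t. c * y t) differentiable (at r) \<and> deriv (\<lambda>t. c * y t) r \<le> G r"
    using C le
  proof eventually_elim
    case (elim r)
    then have "(x has_real_derivative deriv x r) (at r)"
      by (simp add: DERIV_deriv_iff_real_differentiable)
    then have "((\<lambda>t. c * y t) has_real_derivative
       c * (deriv x r * exp (\<mu> * (r - \<sigma>)) + \<mu> * (x r * exp (\<mu> * (r - \<sigma>))))) (at r)"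
      unfolding y_def by (auto intro!: derivative_eq_intros simp: algebra_simps)
    then show ?case using elim by (auto simp: real_differentiable_def DERIV_imp_deriv)
  qed
  ultimately have "c * y t - c * y s \<le> J"
    by (rule abs_continuous_on_increment_le[OF \<open>s \<le> t\<close> _ _ G])
  then show ?thesis by (simp add: y_def right_diff_distrib)
qed

lemma x_continuous: "continuous_on {\<sigma>..T} x"
proof -
  obtain C where C: "AE r in lebesgue_on {\<sigma>..T}. x differentiable (at r) \<and> \<bar>deriv x r\<bar> \<le> C"
    using differentiable_bounded by blast
  have *: "\<bar>x t - x s\<bar> \<le> C * (t - s)" if st: "s \<in> {\<sigma>..T}" "t \<in> {\<sigma>..T}" "s \<le> t" for s t
  proof -
    have C': "AE r in lebesgue_on {s..t}. x differentiable (at r) \<and> \<bar>deriv x r\<bar> \<le> C"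
      using C by (rule AE_lebesgue_on_mono) (use st in auto)
    have const: "((\<lambda>_. C) has_integral C * (t - s)) {s..t}"
      using has_integral_const_real[of C s t] st by (simp add: mult.commute)
    have "e * (x t - x s) \<le> C * (t - s)" if "\<bar>e\<bar> = 1" for e
    proof -
      \<comment> \<open>Exponent 0 turns the weighted increment into the increment of
        \<open>x\<close> itself.\<close>
      have "AE r in lebesgue_on {s..t}.
          e * (deriv x r * exp (0 * (r - \<sigma>)) + 0 * (x r * exp (0 * (r - \<sigma>)))) \<le> C"
        using C'
      proof eventually_elim
        case (elim r)
        have "e * deriv x r \<le> \<bar>deriv x r\<bar>" using that by (metis abs_ge_self abs_mult mult_1)
        then show ?case using elim by simp
      qed
      from weighted_increment_le[OF _ _ const this] st show ?thesis by simp
    qed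
    from this[of 1] this[of "- 1"] st show ?thesis by (simp add: abs_le_iff)
  qed
  have "\<bar>C\<bar>-lipschitz_on {\<sigma>..T} x"
  proof (rule lipschitz_onI)
    fix s t assume st: "s \<in> {\<sigma>..T}" "t \<in> {\<sigma>..T}"
    have **: "\<bar>x v - x u\<bar> \<le> \<bar>C\<bar> * (v - u)" if "u \<in> {\<sigma>..T}" "v \<in> {\<sigma>..T}" "u \<le> v" for u v
      using *[OF that] mult_right_mono[of C "\<bar>C\<bar>" "v - u"] that by linarith
    show "dist (x s) (x t) \<le> \<bar>C\<bar> * dist s t"
      using **[OF st] **[OF st(2,1)] by (cases "s \<le> t") (simp_all add: dist_real_def abs_minus_commute)
  qed simp
  then show ?thesis by (rule lipschitz_on_continuous_on)
qed

text \<open>Over one delay the weight grows by a factor of at most \<open>E\<close>. Values of the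
  solution from \<sigma> on are covered by \<open>Y\<close> and \<open>Z\<close>; if the delayed
  argument lies before \<sigma>, then \<open>t\<close> is within \<open>D\<close> of \<sigma>, so
  the weight at \<open>t\<close> is at most \<open>E\<close> and \<open>K\<close> suffices. The
  exponent may have either sign.\<close>

lemma weighted_derivative_bound:
  assumes E: "\<And>s. 0 \<le> s \<Longrightarrow> s \<le> D \<Longrightarrow> exp (\<mu> * s) \<le> E"
    and Y: "\<And>t. t \<in> {\<sigma>..T} \<Longrightarrow> \<bar>x t\<bar> * exp (\<mu> * (t - \<sigma>)) \<le> Y" "0 \<le> Y"
    and Z: "AE t in lebesgue_on {\<sigma>..T}. \<bar>deriv x t\<bar> * exp (\<mu> * (t - \<sigma>)) \<le> Z" "0 \<le> Z"
  shows "AE t in lebesgue_on {\<sigma>..T}. \<bar>deriv x t\<bar> * exp (\<mu> * (t - \<sigma>)) \<le> E * (a1 * (Z + K) + B * (Y + K))"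
proof -
  have "AE t in lebesgue_on {\<sigma>..T}. t \<in> {\<sigma>..T}" by (simp add: AE_lebesgue_on_iff)
  then show ?thesis
    using equation[of T] coefficient_bounds[of T] AE_delayed[OF Z(1)]
  proof eventually_elim
    case (elim t)
    define \<omega> where "\<omega> = exp (\<mu> * (t - \<sigma>))"
    have "\<omega> > 0" by (simp add: \<omega>_def)
    have t: "t0 \<le> t" "\<sigma> \<le> t" "t \<le> T" using elim \<sigma> by auto
    have "E \<ge> 1" using E[of 0] D by simp
    have shift: "q * \<omega> \<le> E * W" if q: "0 \<le> q" "s \<le> t" "t - s \<le> D"
      and lo: "s \<le> \<sigma> \<Longrightarrow> q \<le> W" and hi: "\<sigma> \<le> s \<Longrightarrow> q * exp (\<mu> * (s - \<sigma>)) \<le> W" for q W s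
    proof (cases "s \<le> \<sigma>")
      case True
      then have "q * \<omega> \<le> W * E" unfolding \<omega>_def
        using q lo t by (intro mult_mono E) auto
      then show ?thesis by (simp add: mult.commute)
    next
      case False
      have "q * \<omega> = (q * exp (\<mu> * (s - \<sigma>))) * exp (\<mu> * (t - s))"
        by (simp add: \<omega>_def mult.assoc exp_add[symmetric] algebra_simps)
      also have "\<dots> \<le> W * E"
        using q hi False E[of "t - s"] by (intro mult_mono) (auto intro: order_trans[rotated])
      finally show ?thesis by (simp add: mult.commute)
    qed
    define X1 where "X1 = (if g t < \<sigma> then \<psi> (g t) else deriv x (g t))"
    define X where "X = (\<lambda>k. if h k t \<le> \<sigma> then \<phi> (h k t) else x (h k t))"
    have X1: "\<bar>X1\<bar> * \<omega> \<le> E * (Z + K)"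
    \<comment> \<open>At \<open>g t = \<sigma>\<close> both cases of \<open>shift\<close> arise; the
      weight there is 1 and the value is \<open>deriv x \<sigma>\<close>, bounded by
      \<open>Z\<close> and not by \<open>K\<close>.\<close>
    proof (cases "g t = \<sigma>")
      case True
      then show ?thesis using elim g[OF t(1)] K_nonneg
        by (intro shift[where s = "\<sigma>"]) (auto simp: X1_def)
    next
      case False
      then show ?thesis using elim g[OF t(1)] \<psi>[of "g t"] K_nonneg Z(2)
        by (intro shift[where s = "g t"]) (auto simp: X1_def)
    qed
    have X: "\<bar>X k\<bar> * \<omega> \<le> E * (Y + K)" if "k \<in> {1..m}" for k
      using h[OF that t(1)] \<phi>[of "h k t"] K_nonneg Y(2) Y(1)[of "h k t"] x_start t
      by (intro shift[where s = "h k t"]) (auto simp: X_def)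
    have "\<bar>deriv x t\<bar> \<le> \<bar>a t * X1\<bar> + \<bar>\<Sum>k=1..m. b k t * X k\<bar>"
      using elim by (simp add: X1_def X_def)
    also have "\<dots> \<le> \<bar>a t\<bar> * \<bar>X1\<bar> + (\<Sum>k=1..m. b k t * \<bar>X k\<bar>)"
      using b_nonneg[OF _ t(1)] by (intro add_mono order_trans[OF sum_abs] sum_mono) (auto simp: abs_mult)
    finally have "\<bar>deriv x t\<bar> * \<omega> \<le> (\<bar>a t\<bar> * \<bar>X1\<bar> + (\<Sum>k=1..m. b k t * \<bar>X k\<bar>)) * \<omega>"
      using \<open>\<omega> > 0\<close> by (intro mult_right_mono) auto
    also have "\<dots> = \<bar>a t\<bar> * (\<bar>X1\<bar> * \<omega>) + (\<Sum>k=1..m. b k t * (\<bar>X k\<bar> * \<omega>))"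
      by (simp add: distrib_right sum_distrib_right mult.assoc)
    also have "\<dots> \<le> a1 * (E * (Z + K)) + (\<Sum>k=1..m. b k t * (E * (Y + K)))"
    proof (intro add_mono sum_mono mult_left_mono X)
      show "\<bar>a t\<bar> * (\<bar>X1\<bar> * \<omega>) \<le> a1 * (E * (Z + K))"
        using elim \<open>\<omega> > 0\<close> a1 by (intro mult_mono[OF _ X1]) auto
    qed (use b_nonneg[OF _ t(1)] in auto)
    also have "(\<Sum>k=1..m. b k t * (E * (Y + K))) = (\<Sum>k=1..m. b k t) * (E * (Y + K))"
      by (simp add: sum_distrib_right)
    also have "\<dots> \<le> B * (E * (Y + K))"
      using elim \<open>E \<ge> 1\<close> Y(2) K_nonneg by (intro mult_right_mono) auto
    finally show ?case by (simp add: \<omega>_def algebra_simps)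
  qed
qed

text \<open>\<open>Y\<close> is a maximum because \<open>x\<close> is continuous; \<open>Z\<close>
  is the least almost-everywhere bound, so \<open>weighted_derivative_bound\<close> yields an
  inequality with \<open>Z\<close> on both sides.\<close>

lemma weighted_sup_norms:
  assumes "\<sigma> \<le> T" and E: "\<And>s. 0 \<le> s \<Longrightarrow> s \<le> D \<Longrightarrow> exp (\<mu> * s) \<le> E"
  obtains Y Z t1 where "0 \<le> Y" "0 \<le> Z" "t1 \<in> {\<sigma>..T}" "Y = \<bar>x t1\<bar> * exp (\<mu> * (t1 - \<sigma>))"
    "\<forall>t\<in>{\<sigma>..T}. \<bar>x t\<bar> * exp (\<mu> * (t - \<sigma>)) \<le> Y"
    "AE t in lebesgue_on {\<sigma>..T}. \<bar>deriv x t\<bar> * exp (\<mu> * (t - \<sigma>)) \<le> Z"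
    "Z \<le> E * (a1 * (Z + K) + B * (Y + K))"
proof -
  have "continuous_on {\<sigma>..T} (\<lambda>t. \<bar>x t\<bar> * exp (\<mu> * (t - \<sigma>)))"
    by (intro continuous_intros x_continuous)
  then obtain t1 where t1: "t1 \<in> {\<sigma>..T}"
    "\<And>t. t \<in> {\<sigma>..T} \<Longrightarrow> \<bar>x t\<bar> * exp (\<mu> * (t - \<sigma>)) \<le> \<bar>x t1\<bar> * exp (\<mu> * (t1 - \<sigma>))"
    using continuous_attains_sup[of "{\<sigma>..T}"] \<open>\<sigma> \<le> T\<close> by fastforce
  obtain C where "AE t in lebesgue_on {\<sigma>..T}. x differentiable (at t) \<and> \<bar>deriv x t\<bar> \<le> C"
    using differentiable_bounded by blast
  moreover have "AE t in lebesgue_on {\<sigma>..T}. t \<in> {\<sigma>..T}" by (simp add: AE_lebesgue_on_iff)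
  ultimately have "AE t in lebesgue_on {\<sigma>..T}. \<bar>deriv x t\<bar> * exp (\<mu> * (t - \<sigma>)) \<le> C * exp (\<bar>\<mu>\<bar> * (T - \<sigma>))"
  proof eventually_elim
    case (elim t)
    have "\<mu> * (t - \<sigma>) \<le> \<bar>\<mu>\<bar> * (T - \<sigma>)" using elim by (intro mult_mono) auto
    then show ?case using elim by (intro mult_mono) auto
  qed
  then obtain Z where Z: "Z \<ge> 0" "AE t in lebesgue_on {\<sigma>..T}. \<bar>deriv x t\<bar> * exp (\<mu> * (t - \<sigma>)) \<le> Z"
    "\<And>C. C \<ge> 0 \<Longrightarrow> AE t in lebesgue_on {\<sigma>..T}. \<bar>deriv x t\<bar> * exp (\<mu> * (t - \<sigma>)) \<le> C \<Longrightarrow> Z \<le> C"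
    by (rule least_AE_bound) blast
  define Y where "Y = \<bar>x t1\<bar> * exp (\<mu> * (t1 - \<sigma>))"
  have "0 \<le> Y" by (simp add: Y_def)
  have Y: "\<And>t. t \<in> {\<sigma>..T} \<Longrightarrow> \<bar>x t\<bar> * exp (\<mu> * (t - \<sigma>)) \<le> Y" using t1 by (simp add: Y_def)
  have "E \<ge> 0" using E[of 0] D by simp
  have "Z \<le> E * (a1 * (Z + K) + B * (Y + K))"
    by (rule Z(3), use \<open>E \<ge> 0\<close> \<open>0 \<le> Y\<close> Z(1) a1 B K_nonneg in simp)
      (rule weighted_derivative_bound[OF E Y \<open>0 \<le> Y\<close> Z(2,1)])
  then show ?thesis using Y by (intro that[OF \<open>0 \<le> Y\<close> Z(1) t1(1) Y_def _ Z(2)]) blast+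
qed

text \<open>The weight with exponent \<open>- growth\<close> is decreasing, so \<open>E = 1\<close>
  is admissible. Integrating \<open>\<bar>deriv x r\<bar> \<le> Z * exp (growth * (r -
  \<sigma>))\<close> up to the point where \<open>Y\<close> is attained gives
  \<open>Y \<le> K + Z / growth\<close>, and the bound on \<open>Z\<close> in terms of
  \<open>Y\<close> closes the estimate.\<close>

lemma initial_bound:
  assumes "t \<in> {\<sigma>..\<sigma> + D}"
  shows "\<bar>x t\<bar> \<le> initial_const * K"
proof -
  define \<Lambda> where "\<Lambda> = growth"
  have \<Lambda>: "1 \<le> \<Lambda>" "2 * B \<le> (1 - a1) * \<Lambda>" using growth by (auto simp: \<Lambda>_def)
  have E: "exp (- \<Lambda> * s) \<le> 1" if "0 \<le> s" "s \<le> D" for s using that \<Lambda> by simp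
  have "\<sigma> \<le> \<sigma> + D" using D by simp
  from weighted_sup_norms[OF this E]
  obtain Y Z t1 where YZ: "0 \<le> Y" "0 \<le> Z" "t1 \<in> {\<sigma>..\<sigma> + D}" "Y = \<bar>x t1\<bar> * exp (- \<Lambda> * (t1 - \<sigma>))"
    "\<forall>t\<in>{\<sigma>..\<sigma> + D}. \<bar>x t\<bar> * exp (- \<Lambda> * (t - \<sigma>)) \<le> Y"
    "AE t in lebesgue_on {\<sigma>..\<sigma> + D}. \<bar>deriv x t\<bar> * exp (- \<Lambda> * (t - \<sigma>)) \<le> Z"
    "Z \<le> 1 * (a1 * (Z + K) + B * (Y + K))" .
  have "((\<lambda>r. Z * exp (\<Lambda> * (r - \<sigma>))) has_integral
      Z / \<Lambda> * exp (\<Lambda> * (t1 - \<sigma>)) - Z / \<Lambda> * exp (\<Lambda> * (\<sigma> - \<sigma>))) {\<sigma>..t1}"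
    using YZ(3) \<Lambda>
    by (intro fundamental_theorem_of_calculus)
      (auto intro!: derivative_eq_intros simp: has_real_derivative_iff_has_vector_derivative[symmetric])
  then have int: "((\<lambda>r. Z * exp (\<Lambda> * (r - \<sigma>))) has_integral Z / \<Lambda> * exp (\<Lambda> * (t1 - \<sigma>)) - Z / \<Lambda>) {\<sigma>..t1}"
    by simp
  have "c * (x t1 - x \<sigma>) \<le> Z / \<Lambda> * exp (\<Lambda> * (t1 - \<sigma>)) - Z / \<Lambda>" if c: "\<bar>c\<bar> = 1" for c
  proof -
    have "AE r in lebesgue_on {\<sigma>..t1}. \<bar>deriv x r\<bar> * exp (- \<Lambda> * (r - \<sigma>)) \<le> Z"
      using YZ(6) by (rule AE_lebesgue_on_mono) (use YZ(3) in auto)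
    then have "AE r in lebesgue_on {\<sigma>..t1}.
      c * (deriv x r * exp (0 * (r - \<sigma>)) + 0 * (x r * exp (0 * (r - \<sigma>)))) \<le> Z * exp (\<Lambda> * (r - \<sigma>))"
    proof eventually_elim
      case (elim r)
      have "c * deriv x r \<le> \<bar>deriv x r\<bar>" using c by (metis abs_ge_self abs_mult mult_1)
      also have "\<dots> = (\<bar>deriv x r\<bar> * exp (- \<Lambda> * (r - \<sigma>))) * exp (\<Lambda> * (r - \<sigma>))"
        by (simp add: mult.assoc exp_add[symmetric])
      also have "\<dots> \<le> Z * exp (\<Lambda> * (r - \<sigma>))" using elim by (intro mult_right_mono) auto
      finally show ?case by simp
    qed
    from weighted_increment_le[OF order_refl _ int this] YZ(3) show ?thesis by simp
  qed
  from this[of 1] this[of "- 1"] have "\<bar>x t1 - x \<sigma>\<bar> \<le> Z / \<Lambda> * exp (\<Lambda> * (t1 - \<sigma>))"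
    using YZ(2) \<Lambda> by (simp add: abs_le_iff) (smt (verit) divide_nonneg_nonneg)
  moreover have "\<bar>x \<sigma>\<bar> \<le> K" using \<phi>[of \<sigma>] x_start by simp
  ultimately have "\<bar>x t1\<bar> \<le> K + Z / \<Lambda> * exp (\<Lambda> * (t1 - \<sigma>))" by linarith
  then have "Y \<le> (K + Z / \<Lambda> * exp (\<Lambda> * (t1 - \<sigma>))) * exp (- \<Lambda> * (t1 - \<sigma>))"
    unfolding YZ(4) by (intro mult_right_mono) auto
  also have "\<dots> = K * exp (- \<Lambda> * (t1 - \<sigma>)) + Z / \<Lambda>"
    by (simp add: distrib_right mult.assoc exp_add[symmetric])
  also have "\<dots> \<le> K * 1 + Z / \<Lambda>"
    using YZ(3) K_nonneg \<Lambda> by (intro add_right_mono mult_left_mono) auto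
  finally have Y: "Y \<le> K + Z / \<Lambda>" by simp
  \<comment> \<open>By the choice of \<Lambda>, \<open>B / \<Lambda> \<le> (1 - a1) / 2\<close>, so
    the part of \<open>Z\<close> produced by \<open>B * Y\<close> consumes only half of
    \<open>(1 - a1) * Z\<close>.\<close>
  have "B * Y \<le> B * K + B / \<Lambda> * Z" using mult_left_mono[OF Y B] by (simp add: algebra_simps)
  moreover have "B / \<Lambda> * Z \<le> (1 - a1) / 2 * Z"
    using \<Lambda> YZ(2) by (intro mult_right_mono) (auto simp: field_simps)
  moreover have "Z \<le> a1 * Z + a1 * K + (B * Y + B * K)" using YZ(7) by (simp add: distrib_left)
  moreover have "(1 - a1) / 2 * Z = Z / 2 - a1 * Z / 2" "(a1 + 2 * B) * K = a1 * K + 2 * (B * K)"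
    by (simp_all add: left_diff_distrib distrib_right diff_divide_distrib)
  ultimately have "(1 - a1) / 2 * Z \<le> (a1 + 2 * B) * K" by linarith
  then have Z: "Z \<le> 2 * (a1 + 2 * B) / (1 - a1) * K" using a1 by (simp add: field_simps)
  have "Z / \<Lambda> \<le> Z" using \<Lambda> YZ(2) by (simp add: field_simps mult_le_cancel_left1)
  then have "Y \<le> (1 + 2 * (a1 + 2 * B) / (1 - a1)) * K" using Y Z by (simp add: distrib_right)
  then have "Y * exp (\<Lambda> * (t - \<sigma>)) \<le> (1 + 2 * (a1 + 2 * B) / (1 - a1)) * K * exp (\<Lambda> * D)"
    using assms \<Lambda> YZ(1) by (intro mult_mono) auto
  moreover have "\<bar>x t\<bar> \<le> Y * exp (\<Lambda> * (t - \<sigma>))"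
    using mult_right_mono[OF bspec[OF YZ(5) assms], of "exp (\<Lambda> * (t - \<sigma>))"]
    by (simp add: mult.assoc exp_add[symmetric])
  ultimately show ?thesis by (simp add: initial_const_def \<Lambda>_def mult_ac)
qed

text \<open>By the product rule \<open>Z + \<mu> * Y\<close> bounds the derivative of the weighted
  solution. This controls the replacement of \<open>h k t\<close> by \<open>\<eta> k t\<close>
  below.\<close>

lemma weighted_lipschitz:
  assumes "0 \<le> \<mu>"
    and Y: "\<And>t. t \<in> {\<sigma>..T} \<Longrightarrow> \<bar>x t\<bar> * exp (\<mu> * (t - \<sigma>)) \<le> Y"
    and Z: "AE t in lebesgue_on {\<sigma>..T}. \<bar>deriv x t\<bar> * exp (\<mu> * (t - \<sigma>)) \<le> Z"
    and st: "\<sigma> \<le> s" "s \<le> t" "t \<le> T"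
  shows "\<bar>x t * exp (\<mu> * (t - \<sigma>)) - x s * exp (\<mu> * (s - \<sigma>))\<bar> \<le> (Z + \<mu> * Y) * (t - s)"
proof -
  have const: "((\<lambda>_. Z + \<mu> * Y) has_integral (Z + \<mu> * Y) * (t - s)) {s..t}"
    using has_integral_const_real[of "Z + \<mu> * Y" s t] st by (simp add: mult.commute)
  have "c * (x t * exp (\<mu> * (t - \<sigma>)) - x s * exp (\<mu> * (s - \<sigma>))) \<le> (Z + \<mu> * Y) * (t - s)"
    if c: "\<bar>c\<bar> = 1" for c
  proof (rule weighted_increment_le[OF st(1,2) const])
    have "AE r in lebesgue_on {s..t}. \<bar>deriv x r\<bar> * exp (\<mu> * (r - \<sigma>)) \<le> Z"
      using Z by (rule AE_lebesgue_on_mono) (use st in auto)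
    moreover have "AE r in lebesgue_on {s..t}. r \<in> {s..t}" by (simp add: AE_lebesgue_on_iff)
    ultimately show "AE r in lebesgue_on {s..t}.
        c * (deriv x r * exp (\<mu> * (r - \<sigma>)) + \<mu> * (x r * exp (\<mu> * (r - \<sigma>)))) \<le> Z + \<mu> * Y"
    proof eventually_elim
      case (elim r)
      have "\<mu> * (\<bar>x r\<bar> * exp (\<mu> * (r - \<sigma>))) \<le> \<mu> * Y"
        using elim st Y[of r] \<open>0 \<le> \<mu>\<close> by (intro mult_left_mono) auto
      moreover have "c * (deriv x r * exp (\<mu> * (r - \<sigma>)) + \<mu> * (x r * exp (\<mu> * (r - \<sigma>))))
         \<le> \<bar>deriv x r * exp (\<mu> * (r - \<sigma>)) + \<mu> * (x r * exp (\<mu> * (r - \<sigma>)))\<bar>"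
        using c by (metis abs_ge_self abs_mult mult_1)
      moreover have "\<dots> \<le> \<bar>deriv x r\<bar> * exp (\<mu> * (r - \<sigma>)) + \<mu> * (\<bar>x r\<bar> * exp (\<mu> * (r - \<sigma>)))"
        using \<open>0 \<le> \<mu>\<close> by (intro order_trans[OF abs_triangle_ineq]) (simp add: abs_mult)
      ultimately show ?case using elim by linarith
    qed
  qed
  from this[of 1] this[of "- 1"] show ?thesis by (simp add: abs_le_iff)
qed

end

section \<open>Comparison with a delay equation satisfying the 1/e condition\<close>

text \<open>The \<open>1/e\<close> condition is imposed only from \<open>t0 + D\<close> on: the coefficients may be negative before \<open>t0\<close>,
  so condition (i) does not control the part of its integral over \<open>[t0, t]\<close> when the delay reaches below \<open>t0\<close>.\<close>

locale neutral_delay_split = neutral_delay +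
  fixes c \<eta> :: "nat \<Rightarrow> real \<Rightarrow> real" and \<beta> A Q R :: real
  assumes c: "\<And>k t. k \<in> {1..m} \<Longrightarrow> t0 \<le> t \<Longrightarrow> 0 \<le> c k t \<and> c k t \<le> b k t"
    and \<beta>: "0 < \<beta>" "\<And>t. t0 \<le> t \<Longrightarrow> \<beta> \<le> (\<Sum>k=1..m. c k t)"
    and \<eta>: "\<And>k t. k \<in> {1..m} \<Longrightarrow> t0 \<le> t \<Longrightarrow> h k t \<le> \<eta> k t \<and> \<eta> k t \<le> t"
    and c_integrable: "\<And>s t. t0 \<le> s \<Longrightarrow> (\<lambda>r. \<Sum>k=1..m. c k r) integrable_on {s..t}"
    and short_delay: "\<And>k t. k \<in> {1..m} \<Longrightarrow> t0 + D \<le> t \<Longrightarrow>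
      integral {\<eta> k t..t} (\<lambda>r. \<Sum>k=1..m. c k r) \<le> 1 / exp 1"
    and nonneg: "0 \<le> A" "0 \<le> Q" "0 \<le> R"
    and A: "AE t in lebesgue_on {t0..}. \<bar>a t\<bar> \<le> A * (\<Sum>k=1..m. c k t)"
    and Q: "AE t in lebesgue_on {t0..}. (\<Sum>k=1..m. b k t - c k t) \<le> Q * (\<Sum>k=1..m. c k t)"
    and R: "AE t in lebesgue_on {t0..}. (\<Sum>k=1..m. c k t * (\<eta> k t - h k t)) \<le> R * (\<Sum>k=1..m. c k t)"
    and criterion: "(A + R) * B / (1 - a1) + Q < 1"
begin

abbreviation c_sum :: "real \<Rightarrow> real" where "c_sum t \<equiv> (\<Sum>k=1..m. c k t)"

text \<open>The four terms are the costs, relative to \<open>c_sum t * Y\<close>, of differentiating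
  the weight, of its change between \<open>h k t\<close> and \<open>t\<close>, of the discarded part
  \<open>b k - c k\<close>, and of the share of \<open>Y\<close> in the Lipschitz estimate for
  replacing \<open>h k t\<close> by \<open>\<eta> k t\<close>.\<close>

definition y_coeff :: "real \<Rightarrow> real" where
  "y_coeff \<mu> = \<mu> / \<beta> + (exp (\<mu> * D) - 1) + exp (\<mu> * D) * Q + \<mu> * R"

text \<open>The first term is the cost of the neutral term, including the change of the weight
  between \<open>g t\<close> and \<open>t\<close>; the second is the share of \<open>Z\<close> in
  the same Lipschitz estimate.\<close>

definition z_coeff :: "real \<Rightarrow> real" where
  "z_coeff \<mu> = A * exp (\<mu> * D) + R"

text \<open>As \<mu> decreases to 0 the last expression tends to
  \<open>Q + (A + R) * B / (1 - a1)\<close>, which \<open>criterion\<close> puts below 1, and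
  \<open>exp (\<mu> * D) * a1\<close> tends to \<open>a1\<close>; a small positive \<mu> satisfies
  both strict inequalities.\<close>

lemma exists_rate:
  obtains \<mu> where "0 < \<mu>" "exp (\<mu> * D) * a1 < 1"
    "y_coeff \<mu> + z_coeff \<mu> * (exp (\<mu> * D) * B / (1 - exp (\<mu> * D) * a1)) < 1"
proof -
  have e: "((\<lambda>\<mu>. exp (\<mu> * D) * a1) \<longlongrightarrow> exp (0 * D) * a1) (at_right 0)"
    by (intro tendsto_intros)
  have "((\<lambda>\<mu>. y_coeff \<mu> + z_coeff \<mu> * (exp (\<mu> * D) * B / (1 - exp (\<mu> * D) * a1))) \<longlongrightarrow>
     (0 / \<beta> + (exp (0 * D) - 1) + exp (0 * D) * Q + 0 * R)
      + (A * exp (0 * D) + R) * (exp (0 * D) * B / (1 - exp (0 * D) * a1))) (at_right 0)"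
    unfolding y_coeff_def z_coeff_def using a1 \<beta> by (intro tendsto_intros) auto
  moreover have "(0 / \<beta> + (exp (0 * D) - 1) + exp (0 * D) * Q + 0 * R)
      + (A * exp (0 * D) + R) * (exp (0 * D) * B / (1 - exp (0 * D) * a1)) < 1"
    using criterion by (simp add: add.commute)
  ultimately have "eventually (\<lambda>\<mu>. y_coeff \<mu> + z_coeff \<mu> * (exp (\<mu> * D) * B / (1 - exp (\<mu> * D) * a1)) < 1) (at_right 0)"
    by (rule order_tendstoD(2))
  moreover have "eventually (\<lambda>\<mu>. exp (\<mu> * D) * a1 < 1) (at_right 0)"
    using order_tendstoD(2)[OF e, of 1] a1 by simp
  moreover have "eventually (\<lambda>\<mu>::real. 0 < \<mu>) (at_right 0)" by (rule eventually_at_right_less)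
  ultimately have "eventually (\<lambda>\<mu>. 0 < \<mu> \<and> exp (\<mu> * D) * a1 < 1 \<and>
      y_coeff \<mu> + z_coeff \<mu> * (exp (\<mu> * D) * B / (1 - exp (\<mu> * D) * a1)) < 1) (at_right 0)"
    by eventually_elim simp
  then show ?thesis using that eventually_happens'[OF trivial_limit_at_right_real] by blast
qed

end

locale neutral_delay_split_solution = neutral_delay_split + neutral_delay_solution
begin

text \<open>From \<open>\<sigma> + D\<close> on every delayed argument is at least \<sigma>, so
  \<phi> and \<psi> drop out of the equation. What then separates the weighted solution from the
  comparison equation is estimated term by term relative to \<open>c_sum t\<close>.\<close>

lemma residual_bound:
  assumes "0 \<le> \<mu>"
    and Y: "\<And>t. t \<in> {\<sigma>..T} \<Longrightarrow> \<bar>x t\<bar> * exp (\<mu> * (t - \<sigma>)) \<le> Y" "0 \<le> Y"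
    and Z: "AE t in lebesgue_on {\<sigma>..T}. \<bar>deriv x t\<bar> * exp (\<mu> * (t - \<sigma>)) \<le> Z" "0 \<le> Z"
  shows "AE t in lebesgue_on {\<sigma> + D..T}.
    \<bar>deriv x t * exp (\<mu> * (t - \<sigma>)) + \<mu> * (x t * exp (\<mu> * (t - \<sigma>)))
      + (\<Sum>k=1..m. c k t * (x (\<eta> k t) * exp (\<mu> * (\<eta> k t - \<sigma>))))\<bar>
      \<le> c_sum t * (y_coeff \<mu> * Y + z_coeff \<mu> * Z)"
proof -
  define E where "E = exp (\<mu> * D)"
  have AE_sub: "AE t in lebesgue_on {\<sigma> + D..T}. P t" if "AE t in lebesgue_on S. P t"
    "{\<sigma> + D..T} \<subseteq> S" "S \<in> sets lebesgue" for P S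
    using that by (rule AE_lebesgue_on_mono) auto
  have "AE t in lebesgue_on {\<sigma> + D..T}. t \<in> {\<sigma> + D..T}" by (simp add: AE_lebesgue_on_iff)
  moreover have "AE t in lebesgue_on {\<sigma> + D..T}.
      deriv x t = a t * (if g t < \<sigma> then \<psi> (g t) else deriv x (g t))
        - (\<Sum>k=1..m. b k t * (if h k t \<le> \<sigma> then \<phi> (h k t) else x (h k t)))"
    by (rule AE_sub[OF equation[of T]]) (use D in auto)
  moreover have "AE t in lebesgue_on {\<sigma> + D..T}.
      \<sigma> \<le> g t \<longrightarrow> \<bar>deriv x (g t)\<bar> * exp (\<mu> * (g t - \<sigma>)) \<le> Z"
    by (rule AE_sub[OF AE_delayed[OF Z(1)]]) (use D in auto)
  moreover have "AE t in lebesgue_on {\<sigma> + D..T}. \<bar>a t\<bar> \<le> A * c_sum t"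
    by (rule AE_sub[OF A]) (use D \<sigma> in auto)
  moreover have "AE t in lebesgue_on {\<sigma> + D..T}. (\<Sum>k=1..m. b k t - c k t) \<le> Q * c_sum t"
    by (rule AE_sub[OF Q]) (use D \<sigma> in auto)
  moreover have "AE t in lebesgue_on {\<sigma> + D..T}. (\<Sum>k=1..m. c k t * (\<eta> k t - h k t)) \<le> R * c_sum t"
    by (rule AE_sub[OF R]) (use D \<sigma> in auto)
  ultimately show ?thesis
  proof eventually_elim
    case (elim t)
    define y where "y = (\<lambda>s. x s * exp (\<mu> * (s - \<sigma>)))"
    define e where "e = (\<lambda>s. exp (\<mu> * (t - s)))"
    have t: "t0 \<le> t" "\<sigma> + D \<le> t" "t \<le> T" using elim(1) D \<sigma> by auto
    \<comment> \<open>The lower bound \<beta> allows the term \<open>\<mu> * y t\<close>, which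
      carries no coefficient, to be measured against \<open>c_sum t\<close>.\<close>
    have C: "0 < c_sum t" "1 \<le> c_sum t / \<beta>" using \<beta>(2)[OF t(1)] \<beta>(1) by auto
    have yb: "\<bar>y s\<bar> \<le> Y" if "\<sigma> \<le> s" "s \<le> T" for s
      using Y(1)[of s] that by (simp add: y_def abs_mult)
    have e: "1 \<le> e s" "e s \<le> E" "0 < e s" if "s \<le> t" "t - s \<le> D" for s
      using that \<open>0 \<le> \<mu>\<close> by (auto simp: e_def E_def intro!: mult_left_mono)
    have shift: "q * exp (\<mu> * (t - \<sigma>)) = q * exp (\<mu> * (s - \<sigma>)) * e s" for q s
      by (simp add: e_def mult.assoc exp_add[symmetric] algebra_simps)
    have gt: "\<sigma> \<le> g t" "g t \<le> t" "t - g t \<le> D" using g[OF t(1)] t by auto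
    have ht: "\<sigma> \<le> h k t" "h k t \<le> t" "t - h k t \<le> D" "h k t \<le> \<eta> k t" "\<eta> k t \<le> t" "0 \<le> c k t" "c k t \<le> b k t"
      if "k \<in> {1..m}" for k
      using h[OF that t(1)] \<eta>[OF that t(1)] c[OF that t(1)] t by auto
    define z where "z = deriv x (g t) * exp (\<mu> * (g t - \<sigma>))"
    have z: "\<bar>z\<bar> \<le> Z" using elim gt by (simp add: z_def abs_mult)
    \<comment> \<open>Here \<phi> could only enter at \<open>h k t = \<sigma>\<close>, where it
      agrees with \<open>x\<close>.\<close>
    have "(\<Sum>k=1..m. b k t * (if h k t \<le> \<sigma> then \<phi> (h k t) else x (h k t))) = (\<Sum>k=1..m. b k t * x (h k t))"
    proof (rule sum.cong[OF refl])
      fix k assume "k \<in> {1..m}"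
      then show "b k t * (if h k t \<le> \<sigma> then \<phi> (h k t) else x (h k t)) = b k t * x (h k t)"
        using ht(1) x_start by (cases "h k t = \<sigma>") (auto simp: not_less dest: order_antisym)
    qed
    then have "deriv x t = a t * deriv x (g t) - (\<Sum>k=1..m. b k t * x (h k t))"
      using elim gt by simp
    then have "deriv x t * exp (\<mu> * (t - \<sigma>)) = a t * (deriv x (g t) * exp (\<mu> * (t - \<sigma>)))
        - (\<Sum>k=1..m. b k t * (x (h k t) * exp (\<mu> * (t - \<sigma>))))"
      by (simp add: left_diff_distrib sum_distrib_right mult.assoc)
    also have "\<dots> = a t * (z * e (g t)) - (\<Sum>k=1..m. b k t * (y (h k t) * e (h k t)))"
      unfolding z_def y_def shift[symmetric] ..
    \<comment> \<open>With the weight ratio \<open>e\<close>, the difference of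
      \<open>c * y(\<eta>)\<close> and \<open>b * y(h) * e\<close> splits into a shift of the
      argument, the discarded coefficient \<open>b - c\<close>, and the change \<open>e - 1\<close>
      of the weight.\<close>
    finally have eq: "deriv x t * exp (\<mu> * (t - \<sigma>)) + \<mu> * y t + (\<Sum>k=1..m. c k t * y (\<eta> k t)) =
       \<mu> * y t + a t * (z * e (g t)) + (\<Sum>k=1..m. c k t * (y (\<eta> k t) - y (h k t))
        - (b k t - c k t) * (y (h k t) * e (h k t)) - c k t * (y (h k t) * (e (h k t) - 1)))"
      by (simp add: sum_subtractf algebra_simps)
    have "\<bar>deriv x t * exp (\<mu> * (t - \<sigma>)) + \<mu> * y t + (\<Sum>k=1..m. c k t * y (\<eta> k t))\<bar>
      \<le> c_sum t / \<beta> * (\<mu> * Y) + A * c_sum t * (Z * E) + (\<Sum>k=1..m. c k t * ((Z + \<mu> * Y) * (\<eta> k t - h k t))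
        + (b k t - c k t) * (Y * E) + c k t * (Y * (E - 1)))"
      unfolding eq
    proof (intro order_trans[OF abs_triangle_ineq] add_mono order_trans[OF sum_abs] sum_mono)
      have "\<bar>\<mu> * y t\<bar> \<le> \<mu> * Y"
        using yb[of t] t D \<open>0 \<le> \<mu>\<close> by (simp add: abs_mult mult_left_mono)
      also have "\<dots> \<le> c_sum t / \<beta> * (\<mu> * Y)"
        using mult_right_mono[OF C(2), of "\<mu> * Y"] \<open>0 \<le> \<mu>\<close> Y(2) by simp
      finally show "\<bar>\<mu> * y t\<bar> \<le> c_sum t / \<beta> * (\<mu> * Y)" .
      have "\<bar>z * e (g t)\<bar> \<le> Z * E" unfolding abs_mult using z e[of "g t"] gt Z(2) by (intro mult_mono) auto
      moreover have "0 \<le> A * c_sum t" using C(1) nonneg by simp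
      ultimately show "\<bar>a t * (z * e (g t))\<bar> \<le> A * c_sum t * (Z * E)"
        unfolding abs_mult[of "a t"] by (intro mult_mono[OF elim(4)]) simp_all
      fix k assume k: "k \<in> {1..m}"
      have lip: "\<bar>y (\<eta> k t) - y (h k t)\<bar> \<le> (Z + \<mu> * Y) * (\<eta> k t - h k t)"
        unfolding y_def using ht[OF k] t
        by (intro weighted_lipschitz[OF \<open>0 \<le> \<mu>\<close> Y(1) Z(1)]) auto
      have "\<bar>y (h k t)\<bar> \<le> Y" using ht[OF k] t by (intro yb) auto
      have "\<bar>c k t * (y (\<eta> k t) - y (h k t))\<bar> \<le> c k t * ((Z + \<mu> * Y) * (\<eta> k t - h k t))"
        using lip ht[OF k] by (simp add: abs_mult mult_left_mono)
      moreover have "\<bar>(b k t - c k t) * (y (h k t) * e (h k t))\<bar> \<le> (b k t - c k t) * (Y * E)"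
        unfolding abs_mult using \<open>\<bar>y (h k t)\<bar> \<le> Y\<close> Y(2) e[of "h k t"] ht[OF k] by (intro mult_mono) auto
      moreover have "\<bar>c k t * (y (h k t) * (e (h k t) - 1))\<bar> \<le> c k t * (Y * (E - 1))"
        unfolding abs_mult using \<open>\<bar>y (h k t)\<bar> \<le> Y\<close> Y(2) e[of "h k t"] ht[OF k] by (intro mult_mono) auto
      ultimately show "\<bar>c k t * (y (\<eta> k t) - y (h k t)) - (b k t - c k t) * (y (h k t) * e (h k t))
          - c k t * (y (h k t) * (e (h k t) - 1))\<bar>
        \<le> c k t * ((Z + \<mu> * Y) * (\<eta> k t - h k t)) + (b k t - c k t) * (Y * E) + c k t * (Y * (E - 1))"
        by linarith
    qed
    also have "(\<Sum>k=1..m. c k t * ((Z + \<mu> * Y) * (\<eta> k t - h k t)) + (b k t - c k t) * (Y * E) + c k t * (Y * (E - 1)))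
       = (Z + \<mu> * Y) * (\<Sum>k=1..m. c k t * (\<eta> k t - h k t)) + (Y * E) * (\<Sum>k=1..m. b k t - c k t) + Y * (E - 1) * c_sum t"
      unfolding sum.distrib sum_distrib_left by (simp add: mult_ac)
    also have "\<dots> \<le> (Z + \<mu> * Y) * (R * c_sum t) + (Y * E) * (Q * c_sum t) + Y * (E - 1) * c_sum t"
      using elim Y(2) Z(2) \<open>0 \<le> \<mu>\<close> by (intro add_mono mult_left_mono order_refl) (auto simp: E_def)
    finally show ?case unfolding y_def E_def y_coeff_def z_coeff_def by (simp add: algebra_simps)
  qed
qed

text \<open>The comparison starts at \<open>\<sigma> + D\<close> with \<open>y\<close> frozen before that point; the freezing changes each
  \<open>y(\<eta>\<^sub>k)\<close> by at most \<open>2 N\<close>.\<close>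

lemma weighted_sup_bound:
  assumes "0 \<le> \<mu>"
    and Y: "\<And>t. t \<in> {\<sigma>..T} \<Longrightarrow> \<bar>x t\<bar> * exp (\<mu> * (t - \<sigma>)) \<le> Y" "0 \<le> Y"
    and Z: "AE t in lebesgue_on {\<sigma>..T}. \<bar>deriv x t\<bar> * exp (\<mu> * (t - \<sigma>)) \<le> Z" "0 \<le> Z"
    and N: "\<And>t. t \<in> {\<sigma>..\<sigma> + D} \<Longrightarrow> \<bar>x t\<bar> * exp (\<mu> * (t - \<sigma>)) \<le> N"
    and t1: "t1 \<in> {\<sigma>..T}"
  shows "\<bar>x t1\<bar> * exp (\<mu> * (t1 - \<sigma>)) \<le> y_coeff \<mu> * Y + z_coeff \<mu> * Z + 2 * N"
proof -
  define y where "y = (\<lambda>s. x s * exp (\<mu> * (s - \<sigma>)))"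
  define F where "F = y_coeff \<mu> * Y + z_coeff \<mu> * Z"
  define \<sigma>' where "\<sigma>' = \<sigma> + D"
  define I where "I = (\<lambda>t. integral {\<sigma>'..t} c_sum)"
  have "1 \<le> exp (\<mu> * D)" using D \<open>0 \<le> \<mu>\<close> by simp
  then have "0 \<le> y_coeff \<mu>" "0 \<le> z_coeff \<mu>"
    using nonneg \<beta>(1) \<open>0 \<le> \<mu>\<close> by (auto simp: y_coeff_def z_coeff_def)
  then have F: "0 \<le> F" using Y(2) Z(2) by (simp add: F_def)
  have N': "\<bar>y t\<bar> \<le> N" if "\<sigma> \<le> t" "t \<le> \<sigma>'" for t
    using N[of t] that by (simp add: y_def \<sigma>'_def abs_mult)
  have N0: "0 \<le> N" using N'[of \<sigma>] D by (auto simp: \<sigma>'_def)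
  have t0\<sigma>: "t0 \<le> \<sigma>'" using \<sigma> D by (simp add: \<sigma>'_def)
  have C: "0 \<le> c_sum t" if "t0 \<le> t" for t using \<beta>(2)[OF that] \<beta>(1) by simp
  have I_diff: "I t - I s = integral {s..t} c_sum" if "\<sigma>' \<le> s" "s \<le> t" for s t
    using Henstock_Kurzweil_Integration.integral_combine[OF that c_integrable[OF t0\<sigma>]]
    by (simp add: I_def)
  have mono: "I s \<le> I t" if "\<sigma>' \<le> s" "s \<le> t" for s t
  proof -
    have "0 \<le> integral {s..t} c_sum"
      by (rule integral_nonneg[OF c_integrable]) (use that t0\<sigma> C in auto)
    then show ?thesis using I_diff[OF that] by simp
  qed
  show ?thesis
  proof (cases "t1 \<le> \<sigma>'")
    case True
    then have "\<bar>y t1\<bar> \<le> N" using t1 by (intro N') auto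
    then have "\<bar>y t1\<bar> \<le> F + 2 * N" using F N0 by linarith
    then show ?thesis by (simp add: F_def y_def abs_mult)
  next
    case False
    have contI: "continuous_on {\<sigma>'..T} I"
      unfolding I_def by (rule indefinite_integral_continuous_1[OF c_integrable[OF t0\<sigma>]])
    have conty: "continuous_on {\<sigma>'..T} y"
      unfolding y_def by (intro continuous_intros continuous_on_subset[OF x_continuous[of T]])
        (use D in \<open>auto simp: \<sigma>'_def\<close>)
    \<comment> \<open>The residual bound says
      \<open>e * (y' + \<Sum> c y(\<eta>)) \<le> F * \<Sum> c\<close>, so \<open>F - e * y\<close>
      satisfies the homogeneous delay inequality for either sign \<open>e\<close>. Adding
      \<open>2 * N\<close> makes room for the freezing.\<close>
    have "0 \<le> F + 2 * N - e * y t1" if e: "\<bar>e\<bar> = 1" for e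
    proof (rule delay_inequality_nonneg[where u = "\<lambda>t. F + 2 * N - e * y t" and t = t1, OF contI])
      have e_le: "e * y t \<le> \<bar>y t\<bar>" "- (e * y t) \<le> \<bar>y t\<bar>" for t
        using e by (metis abs_ge_self abs_mult mult_1, metis abs_ge_minus_self abs_mult mult_1)
      show "0 \<le> F + 2 * N - e * y \<sigma>'"
        using e_le(1)[of \<sigma>'] N'[of \<sigma>'] F N0 D by (auto simp: \<sigma>'_def)
      show "continuous_on {\<sigma>'..T} (\<lambda>t. F + 2 * N - e * y t)" by (intro continuous_intros conty)
      show "t1 \<in> {\<sigma>'..T}" using t1 False by auto
      fix s t assume st: "\<sigma>' \<le> s" "s \<le> t" "t \<le> T"
      then show "I s \<le> I t" by (intro mono)
      fix M
      assume hyp: "\<And>r w. s \<le> r \<Longrightarrow> r \<le> t \<Longrightarrow> \<sigma>' \<le> w \<Longrightarrow> w \<le> r \<Longrightarrow> I r - I w \<le> 1 / exp 1 \<Longrightarrow>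
        F + 2 * N - e * y w \<le> M"
      have int: "((\<lambda>r. M * c_sum r) has_integral M * (I t - I s)) {s..t}"
        unfolding I_diff[OF st(1,2)] using st t0\<sigma>
        by (intro has_integral_mult_right integrable_integral c_integrable) auto
      have "e * (x t * exp (\<mu> * (t - \<sigma>)) - x s * exp (\<mu> * (s - \<sigma>))) \<le> M * (I t - I s)"
      proof (rule weighted_increment_le[OF _ st(2) int])
        show "\<sigma> \<le> s" using st D by (simp add: \<sigma>'_def)
        have "AE r in lebesgue_on {s..t}.
            \<bar>deriv x r * exp (\<mu> * (r - \<sigma>)) + \<mu> * (x r * exp (\<mu> * (r - \<sigma>)))
              + (\<Sum>k=1..m. c k r * y (\<eta> k r))\<bar> \<le> c_sum r * F"
          using residual_bound[OF \<open>0 \<le> \<mu>\<close> Y Z] unfolding F_def y_def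
          by (rule AE_lebesgue_on_mono) (use st in \<open>auto simp: \<sigma>'_def\<close>)
        moreover have "AE r in lebesgue_on {s..t}. r \<in> {s..t}" by (simp add: AE_lebesgue_on_iff)
        ultimately show "AE r in lebesgue_on {s..t}.
          e * (deriv x r * exp (\<mu> * (r - \<sigma>)) + \<mu> * (x r * exp (\<mu> * (r - \<sigma>)))) \<le> M * c_sum r"
        proof eventually_elim
          case (elim r)
          define d where "d = deriv x r * exp (\<mu> * (r - \<sigma>)) + \<mu> * (x r * exp (\<mu> * (r - \<sigma>)))"
          have r: "s \<le> r" "r \<le> t" "\<sigma>' \<le> r" "t0 + D \<le> r" "t0 \<le> r"
            using elim st \<sigma> D by (auto simp: \<sigma>'_def)
          have "e * (d + (\<Sum>k=1..m. c k r * y (\<eta> k r))) \<le> \<bar>d + (\<Sum>k=1..m. c k r * y (\<eta> k r))\<bar>"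
            using e by (metis abs_ge_self abs_mult mult_1)
          also have "\<dots> \<le> c_sum r * F" using elim by (simp add: d_def)
          finally have "e * d \<le> c_sum r * F - e * (\<Sum>k=1..m. c k r * y (\<eta> k r))"
            by (simp add: distrib_left)
          also have "\<dots> = (\<Sum>k=1..m. c k r * (F - e * y (\<eta> k r)))"
            by (simp add: sum_distrib_left sum_distrib_right right_diff_distrib sum_subtractf mult_ac)
          also have "\<dots> \<le> (\<Sum>k=1..m. c k r * M)"
          proof (intro sum_mono mult_left_mono)
            fix k assume k: "k \<in> {1..m}"
            \<comment> \<open>This is the argument after freezing. Moving it to the right only
              shortens the interval up to \<open>r\<close>, and \<open>c_sum\<close> is nonnegative,
              so the bound \<open>1/e\<close> persists.\<close>
            define w where "w = max \<sigma>' (\<eta> k r)"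
            have \<eta>r: "\<sigma> \<le> \<eta> k r" "\<eta> k r \<le> r" "t0 \<le> \<eta> k r"
              using \<eta>[OF k r(5)] h[OF k r(5)] r(3) \<sigma> by (auto simp: \<sigma>'_def)
            have w: "\<sigma>' \<le> w" "w \<le> r" "\<eta> k r \<le> w" using \<eta>r r by (auto simp: w_def)
            have "I r - I w = integral {w..r} c_sum" using w by (intro I_diff)
            also have "\<dots> \<le> integral {\<eta> k r..r} c_sum"
              by (rule integral_subset_le) (use w \<eta>r t0\<sigma> C c_integrable[of w r] c_integrable[of "\<eta> k r" r] in auto)
            also have "\<dots> \<le> 1 / exp 1" by (rule short_delay[OF k r(4)])
            finally have M: "F + 2 * N - e * y w \<le> M" using r w by (intro hyp[of r w])
            show "F - e * y (\<eta> k r) \<le> M"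
            proof (cases "\<sigma>' \<le> \<eta> k r")
              case True
              then show ?thesis using M N0 by (simp add: w_def)
            next
              case False
              \<comment> \<open>Replacing \<open>y (\<eta> k r)\<close> by
                \<open>y \<sigma>'\<close> costs at most \<open>N\<close> for each of the two
                values, which uses up the reserve \<open>2 * N\<close>.\<close>
              then have "w = \<sigma>'" by (simp add: w_def)
              moreover have "e * y \<sigma>' \<le> N" using e_le(1)[of \<sigma>'] N'[of \<sigma>'] D by (simp add: \<sigma>'_def)
              moreover have "- (e * y (\<eta> k r)) \<le> N"
                using e_le(2)[of "\<eta> k r"] N'[of "\<eta> k r"] \<eta>r False by simp
              ultimately show ?thesis using M by simp
            qed
            show "0 \<le> c k r" using c[OF k r(5)] by simp
          qed
          also have "\<dots> = M * c_sum r" by (simp add: sum_distrib_left mult.commute)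
          finally show ?case by (simp add: d_def)
        qed
      qed
      then show "- M * (I t - I s) \<le> F + 2 * N - e * y t - (F + 2 * N - e * y s)"
        by (simp add: y_def right_diff_distrib)
    qed
    from this[of 1] this[of "- 1"] have "\<bar>y t1\<bar> \<le> F + 2 * N" by (simp add: abs_le_iff)
    then show ?thesis by (simp add: F_def y_def abs_mult)
  qed
qed

text \<open>The bound on \<open>Z\<close> is solved for \<open>Z\<close> by means of
  \<open>E * a1 < 1\<close> and inserted into the bound on \<open>Y\<close>. The result has the form
  \<open>Y \<le> \<theta> * Y + const * K\<close> with \<theta> < 1, and its constant does not
  depend on the length of the interval.\<close>

lemma exponential_bound:
  assumes \<mu>: "0 < \<mu>" and E: "E = exp (\<mu> * D)" "E * a1 < 1"
    and \<theta>: "\<theta> = y_coeff \<mu> + z_coeff \<mu> * (E * B / (1 - E * a1))" "\<theta> < 1"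
    and "\<sigma> \<le> t"
  shows "\<bar>x t\<bar> \<le> (2 * E * initial_const + z_coeff \<mu> * (E * (a1 + B) / (1 - E * a1))) / (1 - \<theta>)
    * exp (- \<mu> * (t - \<sigma>)) * K"
proof -
  define T where "T = max t (\<sigma> + D)"
  have "\<sigma> \<le> T" using \<open>\<sigma> \<le> t\<close> by (simp add: T_def)
  have E': "exp (\<mu> * s) \<le> E" if "0 \<le> s" "s \<le> D" for s using that \<mu> by (simp add: E)
  from weighted_sup_norms[OF \<open>\<sigma> \<le> T\<close> E']
  obtain Y Z t1 where Y0: "0 \<le> Y" and Z0: "0 \<le> Z" and t1: "t1 \<in> {\<sigma>..T}" "Y = \<bar>x t1\<bar> * exp (\<mu> * (t1 - \<sigma>))"
    and Y: "\<forall>t\<in>{\<sigma>..T}. \<bar>x t\<bar> * exp (\<mu> * (t - \<sigma>)) \<le> Y"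
    and Z: "AE t in lebesgue_on {\<sigma>..T}. \<bar>deriv x t\<bar> * exp (\<mu> * (t - \<sigma>)) \<le> Z"
      "Z \<le> E * (a1 * (Z + K) + B * (Y + K))" .
  have N: "\<bar>x t\<bar> * exp (\<mu> * (t - \<sigma>)) \<le> initial_const * K * E" if "t \<in> {\<sigma>..\<sigma> + D}" for t
    using that initial_bound[OF that] by (intro mult_mono E') (auto intro: order_trans[OF abs_ge_zero])
  have z: "0 \<le> z_coeff \<mu>" using nonneg by (simp add: z_coeff_def)
  have "Y \<le> y_coeff \<mu> * Y + z_coeff \<mu> * Z + 2 * (initial_const * K * E)"
    unfolding t1(2) by (rule weighted_sup_bound[OF _ _ _ Z(1) Z0 N t1(1)])
      (use \<mu> Y Y0 t1 in auto)
  moreover have "z_coeff \<mu> * Z \<le> z_coeff \<mu> * (E * B / (1 - E * a1) * Y + E * (a1 + B) / (1 - E * a1) * K)"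
  proof (rule mult_left_mono[OF _ z])
    have "(1 - E * a1) * Z \<le> E * B * Y + E * (a1 + B) * K" using Z(2) by (simp add: algebra_simps)
    then have "Z \<le> (E * B * Y + E * (a1 + B) * K) / (1 - E * a1)"
      using E(2) by (simp add: pos_le_divide_eq mult.commute)
    then show "Z \<le> E * B / (1 - E * a1) * Y + E * (a1 + B) / (1 - E * a1) * K"
      by (simp add: add_divide_distrib)
  qed
  ultimately have "Y \<le> \<theta> * Y + (2 * E * initial_const + z_coeff \<mu> * (E * (a1 + B) / (1 - E * a1))) * K"
    unfolding \<theta>(1) distrib_left distrib_right by (simp add: mult_ac)
  then have "(1 - \<theta>) * Y \<le> (2 * E * initial_const + z_coeff \<mu> * (E * (a1 + B) / (1 - E * a1))) * K"
    by (simp add: left_diff_distrib)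
  then have "Y \<le> (2 * E * initial_const + z_coeff \<mu> * (E * (a1 + B) / (1 - E * a1))) / (1 - \<theta>) * K"
    using \<theta>(2) by (simp add: pos_le_divide_eq mult.commute)
  moreover have "\<bar>x t\<bar> * exp (\<mu> * (t - \<sigma>)) \<le> Y" using Y \<open>\<sigma> \<le> t\<close> by (auto simp: T_def)
  ultimately have "\<bar>x t\<bar> * exp (\<mu> * (t - \<sigma>)) * exp (- \<mu> * (t - \<sigma>)) \<le>
     (2 * E * initial_const + z_coeff \<mu> * (E * (a1 + B) / (1 - E * a1))) / (1 - \<theta>) * K * exp (- \<mu> * (t - \<sigma>))"
    by (intro mult_right_mono) auto
  then show ?thesis by (simp add: mult.assoc exp_add[symmetric]) (simp add: mult_ac)
qed

end

context neutral_delay_split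
begin

theorem stable: "exponentially_stable t0 m a g b h"
proof -
  obtain \<mu> where \<mu>: "0 < \<mu>" "exp (\<mu> * D) * a1 < 1"
    "y_coeff \<mu> + z_coeff \<mu> * (exp (\<mu> * D) * B / (1 - exp (\<mu> * D) * a1)) < 1"
    by (rule exists_rate)
  define E where "E = exp (\<mu> * D)"
  define \<theta> where "\<theta> = y_coeff \<mu> + z_coeff \<mu> * (E * B / (1 - E * a1))"
  define M where "M = (2 * E * initial_const + z_coeff \<mu> * (E * (a1 + B) / (1 - E * a1))) / (1 - \<theta>)"
  have "0 < E" by (simp add: E_def)
  have "0 < initial_const"
    unfolding initial_const_def using a1 B by (intro mult_pos_pos add_pos_nonneg divide_nonneg_pos) auto
  moreover have "0 \<le> z_coeff \<mu> * (E * (a1 + B) / (1 - E * a1))"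
    using nonneg a1 B \<mu>(2) \<open>0 < E\<close> by (auto simp: z_coeff_def E_def intro!: mult_nonneg_nonneg divide_nonneg_pos)
  ultimately have "0 < M"
    unfolding M_def using \<mu>(3) \<open>0 < E\<close> by (intro divide_pos_pos add_pos_nonneg mult_pos_pos) (auto simp: \<theta>_def E_def)
  show ?thesis
    unfolding exponentially_stable_def
  proof (rule exI[of _ M], rule conjI[OF \<open>0 < M\<close>], rule exI[of _ \<mu>], rule conjI[OF \<mu>(1)], intro allI impI)
    fix \<sigma> \<phi> \<psi> x t
    assume \<sigma>: "t0 \<le> \<sigma>" and t: "\<sigma> \<le> t"
      and *: "\<phi> \<in> borel_measurable (restrict_space borel {..\<sigma>}) \<and> bounded (\<phi> ` {..\<sigma>}) \<and>
        \<psi> \<in> borel_measurable (restrict_space borel {..<\<sigma>}) \<and> bounded (\<psi> ` {..<\<sigma>}) \<and>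
        neutral_solution m a g b h \<sigma> \<phi> \<psi> x"
    \<comment> \<open>Both summands are nonnegative, so \<open>K\<close> bounds \<phi> and \<psi>
      separately; \<open>M\<close> and \<mu> were fixed before \<sigma>, \<phi> and \<psi>.\<close>
    define K where "K = (SUP s\<in>{..\<sigma>}. \<bar>\<phi> s\<bar> + \<bar>if s < \<sigma> then \<psi> s else 0\<bar>)"
    obtain P where P: "\<And>s. s \<le> \<sigma> \<Longrightarrow> \<bar>\<phi> s\<bar> \<le> P" using * by (force simp: bounded_iff)
    obtain P' where P': "\<And>s. s < \<sigma> \<Longrightarrow> \<bar>\<psi> s\<bar> \<le> P'" using * by (force simp: bounded_iff)
    have "bdd_above ((\<lambda>s. \<bar>\<phi> s\<bar> + \<bar>if s < \<sigma> then \<psi> s else 0\<bar>) ` {..\<sigma>})"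
    proof (rule bdd_aboveI2)
      fix s assume "s \<in> {..\<sigma>}"
      then show "\<bar>\<phi> s\<bar> + \<bar>if s < \<sigma> then \<psi> s else 0\<bar> \<le> P + \<bar>P'\<bar>"
        using P[of s] P'[of s] by auto
    qed
    then have K: "\<bar>\<phi> s\<bar> + \<bar>if s < \<sigma> then \<psi> s else 0\<bar> \<le> K" if "s \<le> \<sigma>" for s
      unfolding K_def using that by (intro cSUP_upper) auto
    interpret neutral_delay_split_solution t0 a1 B D m a g b h c \<eta> \<beta> A Q R \<sigma> K \<phi> \<psi> x
    proof unfold_locales
      show "\<bar>\<phi> s\<bar> \<le> K" if "s \<le> \<sigma>" for s using K[OF that] by linarith
      show "\<bar>\<psi> s\<bar> \<le> K" if "s < \<sigma>" for s using K[of s] that by simp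
    qed (use \<sigma> * in auto)
    show "\<bar>x t\<bar> \<le> M * exp (- \<mu> * (t - \<sigma>)) * (SUP s\<in>{..\<sigma>}. \<bar>\<phi> s\<bar> + \<bar>if s < \<sigma> then \<psi> s else 0\<bar>)"
      unfolding K_def[symmetric] M_def
      using \<mu> t by (intro exponential_bound) (auto simp: E_def \<theta>_def)
  qed
qed

end

section \<open>Essential norms and the stability conditions\<close>

text \<open>A half-line is not a null set, so the exceptional set cannot be all of it.\<close>

lemma AE_half_line_const:
  assumes "AE t in lebesgue_on {c::real..}. P"
  shows P
proof (rule ccontr)
  assume "\<not> P"
  have "AE t in lebesgue_on {c..}. t \<notin> {c..}" by (rule eventually_mono[OF assms]) (use \<open>\<not> P\<close> in auto)
  then have "AE t in lebesgue. t \<notin> {c..}" by (simp add: AE_lebesgue_on_iff)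
  then have "{c..} \<in> null_sets lebesgue" by (subst AE_iff_null_sets) auto
  then have "{c..c+1} \<in> null_sets lebesgue" by (rule null_sets_subset) auto
  then show False by (simp add: null_sets_def)
qed

lemma ess_norm_nonneg: "0 \<le> ess_norm c f"
proof -
  have "AE t in lebesgue_on {c..}. ereal \<bar>f t\<bar> \<le> ess_norm c f"
    unfolding ess_norm_def by (rule esssup_AE)
  then have "AE t in lebesgue_on {c..}. 0 \<le> ess_norm c f"
    by eventually_elim (erule order_trans[rotated], simp)
  then show ?thesis by (rule AE_half_line_const)
qed

lemma ess_norm_finite:
  assumes "ess_norm c f \<noteq> \<infinity>"
  obtains r where "0 \<le> r" "ess_norm c f = ereal r" "AE t in lebesgue_on {c..}. \<bar>f t\<bar> \<le> r"
proof -
  obtain r where r: "ess_norm c f = ereal r" "0 \<le> r"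
    using assms ess_norm_nonneg[of c f] by (cases "ess_norm c f") auto
  have "AE t in lebesgue_on {c..}. ereal \<bar>f t\<bar> \<le> ess_norm c f"
    unfolding ess_norm_def by (rule esssup_AE)
  then have "AE t in lebesgue_on {c..}. \<bar>f t\<bar> \<le> r" by (simp add: r)
  then show ?thesis using r that by blast
qed

lemma ess_norm_le:
  assumes "f \<in> borel_measurable (lebesgue_on {c..})" "AE t in lebesgue_on {c..}. \<bar>f t\<bar> \<le> r"
  shows "ess_norm c f \<le> ereal r"
  unfolding ess_norm_def using assms by (intro esssup_I) auto

text \<open>Both integrals are needed: the comparison argument uses the gauge integral, condition
  (i) the Lebesgue integral.\<close>

lemma half_line_integral:
  fixes f :: "real \<Rightarrow> real"
  assumes f: "f \<in> borel_measurable (lebesgue_on {c..})" and C: "AE t in lebesgue_on {c..}. \<bar>f t\<bar> \<le> C"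
    and "c \<le> s"
  shows "integrable (lebesgue_on {s..t}) f" "f integrable_on {s..t}"
    and "s \<le> t \<Longrightarrow> integral {s..t} f \<le> C * (t - s)"
proof -
  interpret finite_measure "lebesgue_on {s..t}"
    by (rule finite_measure_lebesgue_on) auto
  have C': "AE r in lebesgue_on {s..t}. \<bar>f r\<bar> \<le> C"
    using C by (rule AE_lebesgue_on_mono) (use \<open>c \<le> s\<close> in auto)
  have f': "f \<in> borel_measurable (lebesgue_on {s..t})"
    using f by (rule measurable_restrict_mono) (use \<open>c \<le> s\<close> in auto)
  show i: "integrable (lebesgue_on {s..t}) f"
    by (rule integrable_const_bound[where B = C]) (use C' f' in auto)
  then show "f integrable_on {s..t}" by (rule integrable_on_lebesgue_on) auto
  assume "s \<le> t"
  have "integral {s..t} f = integral\<^sup>L (lebesgue_on {s..t}) f"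
    using i by (rule lebesgue_integral_eq_integral[symmetric]) auto
  also have "\<dots> \<le> integral\<^sup>L (lebesgue_on {s..t}) (\<lambda>_. C)"
    by (rule integral_mono_AE[OF i]) (use C' in \<open>auto elim: eventually_mono\<close>)
  also have "\<dots> = C * (t - s)" using \<open>s \<le> t\<close> by (simp add: measure_restrict_space mult.commute)
  finally show "integral {s..t} f \<le> C * (t - s)" .
qed

theorem theorem5p2:
  fixes t0 a0 \<delta> \<beta> \<tau>_max :: real and m :: nat
    and a g b_sum h_min b0 :: "real \<Rightarrow> real"
    and b h :: "nat \<Rightarrow> real \<Rightarrow> real" and \<tau> :: "nat \<Rightarrow> real"
  assumes "t0 \<ge> 0" and "m \<ge> 1"
    and "a \<in> borel_measurable (lebesgue_on {0..})"
    and "g \<in> borel_measurable (lebesgue_on {0..})"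
    and "\<And>k. k \<in> {1..m} \<Longrightarrow> b k \<in> borel_measurable (lebesgue_on {0..})"
    and "\<And>k. k \<in> {1..m} \<Longrightarrow> h k \<in> borel_measurable (lebesgue_on {0..})"
    and "ess_norm 0 a < \<infinity>"
    and "\<And>k. k \<in> {1..m} \<Longrightarrow> ess_norm 0 (b k) < \<infinity>"
    and "ess_norm t0 a \<le> ereal a0" and "a0 < 1"
    and "\<And>k t. k \<in> {1..m} \<Longrightarrow> t \<ge> t0 \<Longrightarrow> b k t \<ge> 0"
    and "\<And>t. t \<ge> 0 \<Longrightarrow> 0 \<le> t - g t \<and> t - g t \<le> \<delta>"
    and "\<And>k t. k \<in> {1..m} \<Longrightarrow> t \<ge> 0 \<Longrightarrow> 0 \<le> t - h k t \<and> t - h k t \<le> \<tau> k"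
    and "\<And>E. E \<in> null_sets lebesgue \<Longrightarrow> {t. t \<ge> 0 \<and> g t \<in> E} \<in> null_sets lebesgue"
    and "b_sum = (\<lambda>t. \<Sum>k=1..m. b k t)"
    and "h_min = (\<lambda>t. Min ((\<lambda>k. h k t) ` {1..m}))"
    and "\<tau>_max = Max (\<tau> ` {1..m})" and "\<tau>_max > 0"
    and "b0 = (\<lambda>t. min (b_sum t) (1 / (\<tau>_max * exp 1)))"
    and "\<beta> > 0" and "\<And>t. t \<ge> t0 \<Longrightarrow> b_sum t \<ge> \<beta>"
    and "((\<forall>t\<ge>t0. (LINT s:{h_min t..t}|lebesgue. (if s < 0 then 0 else b_sum s)) \<le> 1 / exp 1) \<and>
          ess_norm t0 a + ess_norm t0 b_sum * ess_norm t0 (\<lambda>t. a t / b_sum t) < 1)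
       \<or>
         ess_norm t0 (\<lambda>t. a t / b0 t) * (ess_norm t0 b_sum / (1 - ess_norm t0 a))
           + ess_norm t0 (\<lambda>t. (b_sum t - b0 t) / b0 t) < 1
       \<or>
         ess_norm t0 b_sum *
           (ess_norm t0 (\<lambda>t. a t / b_sum t) +
            ess_norm t0 (\<lambda>t. max (t - h_min t - 1 / (real_of_ereal (ess_norm t0 b_sum) * exp 1)) 0))
         < 1 - ess_norm t0 a"
  shows "exponentially_stable t0 m a g b h"
proof -

  \<comment> \<open>Constants and finite norms common to the three conditions\<close>
  define D where "D = max \<delta> \<tau>_max"
  have D: "0 < D" "\<delta> \<le> D" using \<open>\<tau>_max > 0\<close> by (auto simp: D_def)
  have \<tau>: "\<tau> k \<le> D" if "k \<in> {1..m}" for k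
  proof -
    have "\<tau> k \<le> \<tau>_max" unfolding \<open>\<tau>_max = Max (\<tau> ` {1..m})\<close> using that by (intro Max_ge) auto
    then show ?thesis by (simp add: D_def)
  qed
  have hD: "h k t \<le> t \<and> t - h k t \<le> D \<and> t - h k t \<le> \<tau>_max \<and> h_min t \<le> h k t" if "k \<in> {1..m}" "t0 \<le> t" for k t
  proof -
    have "\<tau> k \<le> \<tau>_max" unfolding \<open>\<tau>_max = Max (\<tau> ` {1..m})\<close> using that by (intro Max_ge) auto
    moreover have "h_min t \<le> h k t"
      unfolding \<open>h_min = (\<lambda>t. Min ((\<lambda>k. h k t) ` {1..m}))\<close> using that by (intro Min_le) auto
    ultimately show ?thesis
      using assms(13)[OF that(1), of t] \<tau>[OF that(1)] \<open>0 \<le> t0\<close> that(2) by auto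
  qed
  have gD: "g t \<le> t \<and> t - g t \<le> D" if "t0 \<le> t" for t
    using assms(12)[of t] \<open>0 \<le> t0\<close> that D(2) by auto
  have b_sum: "b_sum t = (\<Sum>k=1..m. b k t)" for t using assms(15) by simp
  have b_pos: "0 < b_sum t" "0 \<le> b_sum t" if "t0 \<le> t" for t
    using assms(21)[OF that] \<open>\<beta> > 0\<close> by auto
  have meas: "f \<in> borel_measurable (lebesgue_on {t0..})" if "f \<in> borel_measurable (lebesgue_on {0..})" for f :: "real \<Rightarrow> real"
    using that by (rule measurable_restrict_mono) (use \<open>0 \<le> t0\<close> in auto)
  have b_sum_meas: "b_sum \<in> borel_measurable (lebesgue_on {t0..})"
    unfolding assms(15) by (intro borel_measurable_sum meas assms(5))
  obtain a1 where a1: "0 \<le> a1" "ess_norm t0 a = ereal a1" "AE t in lebesgue_on {t0..}. \<bar>a t\<bar> \<le> a1"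
    by (rule ess_norm_finite[of t0 a]) (use assms(9) in auto)
  have a1_less: "a1 < 1" using assms(9,10) a1(2) by simp
  have "\<exists>C. AE t in lebesgue_on {t0..}. \<bar>b k t\<bar> \<le> C" if k: "k \<in> {1..m}" for k
  proof -
    obtain r where "AE t in lebesgue_on {0..}. \<bar>b k t\<bar> \<le> r"
      by (rule ess_norm_finite[of 0 "b k"]) (use assms(8)[OF k] in auto)
    then have "AE t in lebesgue_on {t0..}. \<bar>b k t\<bar> \<le> r"
      by (rule AE_lebesgue_on_mono) (use \<open>0 \<le> t0\<close> in auto)
    then show ?thesis ..
  qed
  then obtain C where C: "\<And>k. k \<in> {1..m} \<Longrightarrow> AE t in lebesgue_on {t0..}. \<bar>b k t\<bar> \<le> C k" by metis
  have "AE t in lebesgue_on {t0..}. \<forall>k\<in>{1..m}. \<bar>b k t\<bar> \<le> C k"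
    by (rule AE_finite_allI) (use C in auto)
  then have "AE t in lebesgue_on {t0..}. \<bar>b_sum t\<bar> \<le> (\<Sum>k=1..m. C k)"
    by eventually_elim (auto simp: b_sum intro!: order_trans[OF sum_abs] sum_mono)
  from ess_norm_le[OF b_sum_meas this] have "ess_norm t0 b_sum \<noteq> \<infinity>" by auto
  then obtain B where B: "0 \<le> B" "ess_norm t0 b_sum = ereal B" "AE t in lebesgue_on {t0..}. \<bar>b_sum t\<bar> \<le> B"
    by (rule ess_norm_finite)
  have ge_t0: "AE t in lebesgue_on {t0..}. t0 \<le> t" by (simp add: AE_lebesgue_on_iff)
  \<comment> \<open>Positivity of \<open>B\<close> matters in the extended reals, where 0 times
    infinity is 0: only with a positive factor does a finite product force the other norm to be
    finite.\<close>
  have "AE t in lebesgue_on {t0..}. \<beta> \<le> B"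
    using B(3) ge_t0
  proof eventually_elim
    case (elim t)
    then show ?case using assms(21)[of t] by simp
  qed
  then have "\<beta> \<le> B" by (rule AE_half_line_const)
  then have B_pos: "0 < B" using \<open>\<beta> > 0\<close> by simp
  have quotient: "AE t in lebesgue_on {t0..}. \<bar>p t\<bar> \<le> A * q t"
    if "AE t in lebesgue_on {t0..}. \<bar>p t / q t\<bar> \<le> A" "\<And>t. t0 \<le> t \<Longrightarrow> 0 < q t" for p q :: "real \<Rightarrow> real" and A
    using that(1) ge_t0
  proof eventually_elim
    case (elim t)
    then show ?case using that(2)[of t] by (simp add: pos_divide_le_eq)
  qed
  interpret eq: neutral_delay t0 a1 B D m a g b h
  proof unfold_locales
    show "AE t in lebesgue_on {t0..}. (\<Sum>k=1..m. b k t) \<le> B"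
      using B(3) by eventually_elim (simp add: b_sum)
  qed (use a1 a1_less B(1) D(1) gD hD assms(1,11,14) in auto)
  note b_int = half_line_integral[OF b_sum_meas B(3)]
  show ?thesis
    using assms(22)
  proof (elim disjE conjE)

    \<comment> \<open>Condition (i): comparison with the coefficients and delays of the
      equation\<close>
    assume i: "\<forall>t\<ge>t0. (LINT s:{h_min t..t}|lebesgue. (if s < 0 then 0 else b_sum s)) \<le> 1 / exp 1"
      and lt: "ess_norm t0 a + ess_norm t0 b_sum * ess_norm t0 (\<lambda>t. a t / b_sum t) < 1"
    have "ess_norm t0 (\<lambda>t. a t / b_sum t) \<noteq> \<infinity>" using lt B_pos by (auto simp: a1 B)
    then obtain A where A: "0 \<le> A" "ess_norm t0 (\<lambda>t. a t / b_sum t) = ereal A"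
      "AE t in lebesgue_on {t0..}. \<bar>a t / b_sum t\<bar> \<le> A"
      by (rule ess_norm_finite)
    have crit: "(A + 0) * B / (1 - a1) + 0 < 1"
      using lt a1_less by (simp add: a1(2) B(2) A(2) field_simps)
    interpret split: neutral_delay_split t0 a1 B D m a g b h b h \<beta> A 0 0
    proof (unfold_locales; (fold b_sum)?)
      fix k t assume k: "k \<in> {1..m}" and t: "t0 + D \<le> t"
      have "h_min t \<in> (\<lambda>k. h k t) ` {1..m}"
        unfolding assms(16) using \<open>m \<ge> 1\<close> by (intro Min_in) auto
      \<comment> \<open>From \<open>t0 + D\<close> on the interval of integration starts at or after
        \<open>t0\<close>, where the coefficients are nonnegative and the truncation at negative
        arguments has no effect.\<close>
      then have hm: "t0 \<le> h_min t" "h_min t \<le> t" using hD[of _ t] t D(1) by force+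
      have hk: "h_min t \<le> h k t" "h k t \<le> t" "t0 \<le> h k t" using hD[OF k, of t] t D(1) by auto
      have "integral {h k t..t} b_sum \<le> integral {h_min t..t} b_sum"
        by (rule integral_subset_le) (use hm hk b_int(2)[of _ t] b_pos in auto)
      also have "\<dots> = integral\<^sup>L (lebesgue_on {h_min t..t}) b_sum"
        using b_int(1)[OF hm(1)] by (rule lebesgue_integral_eq_integral[symmetric]) auto
      also have "\<dots> = (LINT s:{h_min t..t}|lebesgue. b_sum s)"
        unfolding set_lebesgue_integral_def by (rule integral_restrict_space) auto
      also have "\<dots> = (LINT s:{h_min t..t}|lebesgue. (if s < 0 then 0 else b_sum s))"
        by (rule set_lebesgue_integral_cong) (use hm \<open>0 \<le> t0\<close> in auto)
      also have "\<dots> \<le> 1 / exp 1" using i t D(1) by auto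
      finally show "integral {h k t..t} b_sum \<le> 1 / exp 1" .
    qed (use assms(11,20,21) hD A(1) quotient[OF A(3)] b_pos b_int(2) crit in auto)
    show ?thesis by (rule split.stable)
  next

    \<comment> \<open>Condition (ii): coefficients scaled down to the sum \<open>b0\<close>\<close>
    assume lt: "ess_norm t0 (\<lambda>t. a t / b0 t) * (ess_norm t0 b_sum / (1 - ess_norm t0 a))
      + ess_norm t0 (\<lambda>t. (b_sum t - b0 t) / b0 t) < 1"
    \<comment> \<open>Coefficients with sum at most \<open>L\<close> integrate to at most
      \<open>L * \<tau>_max = 1/e\<close> over each delay.\<close>
    define L where "L = 1 / (\<tau>_max * exp 1)"
    have L: "0 < L" "L * \<tau>_max = 1 / exp 1" using \<open>\<tau>_max > 0\<close> by (auto simp: L_def)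
    have b0: "b0 t = min (b_sum t) L" for t by (simp add: assms(19) L_def)
    have b0_bounds: "0 < b0 t" "b0 t \<le> b_sum t" "b0 t \<le> L" "min \<beta> L \<le> b0 t" if "t0 \<le> t" for t
      using b_pos[OF that] assms(21)[OF that] L by (auto simp: b0)
    have frac: "ess_norm t0 b_sum / (1 - ess_norm t0 a) = ereal (B / (1 - a1))"
      using a1_less by (simp add: a1(2) B(2) one_ereal_def)
    have "0 < B / (1 - a1)" using B_pos a1_less by simp
    then have fin: "ess_norm t0 (\<lambda>t. a t / b0 t) \<noteq> \<infinity>"
    proof (intro notI)
      assume *: "ess_norm t0 (\<lambda>t. a t / b0 t) = \<infinity>" and pos: "0 < B / (1 - a1)"
      have inf: "\<infinity> * ereal q = \<infinity>" if "0 < q" for q using that by simp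
      have "\<infinity> + ess_norm t0 (\<lambda>t. (b_sum t - b0 t) / b0 t) < (1 :: ereal)"
        using lt unfolding frac * inf[OF pos] .
      then show False by simp
    qed
    obtain A where A: "0 \<le> A" "ess_norm t0 (\<lambda>t. a t / b0 t) = ereal A"
      "AE t in lebesgue_on {t0..}. \<bar>a t / b0 t\<bar> \<le> A"
      using fin by (rule ess_norm_finite)
    have fin': "ess_norm t0 (\<lambda>t. (b_sum t - b0 t) / b0 t) \<noteq> \<infinity>"
      using lt unfolding frac A(2) by auto
    obtain Q where Q: "0 \<le> Q" "ess_norm t0 (\<lambda>t. (b_sum t - b0 t) / b0 t) = ereal Q"
      "AE t in lebesgue_on {t0..}. \<bar>(b_sum t - b0 t) / b0 t\<bar> \<le> Q"
      using fin' by (rule ess_norm_finite)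
    have crit: "(A + 0) * B / (1 - a1) + Q < 1" using lt unfolding frac A(2) Q(2) by simp
    \<comment> \<open>All \<open>b k\<close> are scaled by the common factor
      \<open>b0 / b_sum \<le> 1\<close>; the discarded part has sum \<open>b_sum - b0\<close>, which
      \<open>Q\<close> measures relative to \<open>b0\<close>.\<close>
    define c where "c = (\<lambda>k t. b k t * (b0 t / b_sum t))"
    have c_sum: "(\<Sum>k=1..m. c k t) = b0 t" if "t0 \<le> t" for t
      using b_pos[OF that] unfolding c_def sum_distrib_right[symmetric] b_sum[symmetric] by simp
    have b0_meas: "b0 \<in> borel_measurable (lebesgue_on {t0..})"
      unfolding b0[abs_def] using b_sum_meas by measurable
    have b0_le: "AE t in lebesgue_on {t0..}. \<bar>b0 t\<bar> \<le> L"
      using ge_t0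
    proof eventually_elim
      case (elim t)
      then show ?case using b0_bounds[of t] by simp
    qed
    note b0_int = half_line_integral[OF b0_meas b0_le]
    interpret split: neutral_delay_split t0 a1 B D m a g b h c h "min \<beta> L" A Q 0
    proof unfold_locales
      fix k t assume k: "k \<in> {1..m}" and t: "t0 \<le> t"
      have "0 \<le> b0 t / b_sum t" "b0 t / b_sum t \<le> 1" using b0_bounds[OF t] b_pos[OF t] by auto
      then show "0 \<le> c k t \<and> c k t \<le> b k t"
        unfolding c_def using assms(11)[OF k t] by (intro conjI mult_nonneg_nonneg mult_left_le)
    next
      fix t assume "t0 \<le> t"
      then show "min \<beta> L \<le> (\<Sum>k=1..m. c k t)" using b0_bounds(4) c_sum by simp
    next
      fix s t assume "t0 \<le> s"
      then show "(\<lambda>r. \<Sum>k=1..m. c k r) integrable_on {s..t}"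
        by (intro integrable_eq[OF b0_int(2)]) (use c_sum in auto)
    next
      fix k t assume k: "k \<in> {1..m}" and t: "t0 + D \<le> t"
      have hk: "h k t \<le> t" "t0 \<le> h k t" "t - h k t \<le> \<tau>_max" using hD[OF k, of t] t D(1) by auto
      have "integral {h k t..t} (\<lambda>r. \<Sum>k=1..m. c k r) = integral {h k t..t} b0"
        by (rule integral_cong) (use hk c_sum in auto)
      also have "\<dots> \<le> L * (t - h k t)" using hk by (intro b0_int(3))
      also have "\<dots> \<le> L * \<tau>_max" using hk L by (intro mult_left_mono) auto
      finally show "integral {h k t..t} (\<lambda>r. \<Sum>k=1..m. c k r) \<le> 1 / exp 1" using L by simp
    next
      have "AE t in lebesgue_on {t0..}. \<bar>a t\<bar> \<le> A * b0 t"
        by (rule quotient[OF A(3)]) (rule b0_bounds(1))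
      then show "AE t in lebesgue_on {t0..}. \<bar>a t\<bar> \<le> A * (\<Sum>k=1..m. c k t)"
        using ge_t0 by eventually_elim (simp only: c_sum)
      have "AE t in lebesgue_on {t0..}. \<bar>b_sum t - b0 t\<bar> \<le> Q * b0 t"
        by (rule quotient[OF Q(3)]) (rule b0_bounds(1))
      then show "AE t in lebesgue_on {t0..}. (\<Sum>k=1..m. b k t - c k t) \<le> Q * (\<Sum>k=1..m. c k t)"
        using ge_t0
      proof eventually_elim
        case (elim t)
        have "(\<Sum>k=1..m. b k t - c k t) = b_sum t - b0 t"
          by (simp only: sum_subtractf c_sum[OF elim(2)] b_sum)
        then show ?case using elim by (simp only: c_sum)
      qed
    qed (use L \<open>\<beta> > 0\<close> hD A(1) Q(1) crit in auto)
    show ?thesis by (rule split.stable)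
  next

    \<comment> \<open>Condition (iii): delays shortened to at most \<open>L\<close>\<close>
    assume lt: "ess_norm t0 b_sum * (ess_norm t0 (\<lambda>t. a t / b_sum t) +
        ess_norm t0 (\<lambda>t. max (t - h_min t - 1 / (real_of_ereal (ess_norm t0 b_sum) * exp 1)) 0))
      < 1 - ess_norm t0 a"
    \<comment> \<open>Over a delay of this length coefficients with sum at most \<open>B\<close>
      integrate to at most \<open>1/e\<close>.\<close>
    define L where "L = 1 / (B * exp 1)"
    have L: "0 < L" "B * L = 1 / exp 1" using B_pos by (auto simp: L_def)
    have lt': "ereal B * (ess_norm t0 (\<lambda>t. a t / b_sum t) + ess_norm t0 (\<lambda>t. max (t - h_min t - L) 0)) < ereal (1 - a1)"
      using lt by (simp add: a1(2) B(2) L_def one_ereal_def)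
    have fin: "ess_norm t0 (\<lambda>t. a t / b_sum t) \<noteq> \<infinity>" "ess_norm t0 (\<lambda>t. max (t - h_min t - L) 0) \<noteq> \<infinity>"
      using lt' B_pos ess_norm_nonneg[of t0 "\<lambda>t. a t / b_sum t"] by auto
    obtain A where A: "0 \<le> A" "ess_norm t0 (\<lambda>t. a t / b_sum t) = ereal A"
      "AE t in lebesgue_on {t0..}. \<bar>a t / b_sum t\<bar> \<le> A"
      using fin(1) by (rule ess_norm_finite)
    obtain R where R: "0 \<le> R" "ess_norm t0 (\<lambda>t. max (t - h_min t - L) 0) = ereal R"
      "AE t in lebesgue_on {t0..}. \<bar>max (t - h_min t - L) 0\<bar> \<le> R"
      using fin(2) by (rule ess_norm_finite)
    have "B * (A + R) < 1 - a1" using lt' unfolding A(2) R(2) by simp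
    then have crit: "(A + R) * B / (1 - a1) + 0 < 1" using a1_less by (simp add: mult.commute)
    define \<eta> where "\<eta> = (\<lambda>k t. max (h k t) (t - L))"
    interpret split: neutral_delay_split t0 a1 B D m a g b h b \<eta> \<beta> A 0 R
    proof (unfold_locales; (fold b_sum)?)
      fix k t assume k: "k \<in> {1..m}" and t: "t0 + D \<le> t"
      have \<eta>k: "\<eta> k t \<le> t" "t0 \<le> \<eta> k t" "t - \<eta> k t \<le> L" using hD[OF k, of t] t D(1) L by (auto simp: \<eta>_def)
      have "integral {\<eta> k t..t} b_sum \<le> B * (t - \<eta> k t)" using \<eta>k by (intro b_int(3))
      also have "\<dots> \<le> B * L" using \<eta>k B_pos by (intro mult_left_mono) auto
      finally show "integral {\<eta> k t..t} b_sum \<le> 1 / exp 1" using L by simp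
    next
      show "AE t in lebesgue_on {t0..}. (\<Sum>k=1..m. b k t * (\<eta> k t - h k t)) \<le> R * b_sum t"
        using R(3) ge_t0
      proof eventually_elim
        case (elim t)
        have "(\<Sum>k=1..m. b k t * (\<eta> k t - h k t)) \<le> (\<Sum>k=1..m. b k t * R)"
        proof (intro sum_mono mult_left_mono)
          fix k assume k: "k \<in> {1..m}"
          \<comment> \<open>The shift is the positive part of \<open>t - h k t - L\<close>, which
            does not decrease when \<open>h k t\<close> is replaced by
            \<open>h_min t\<close>.\<close>
          show "\<eta> k t - h k t \<le> R" using hD[OF k elim(2)] elim(1) by (auto simp: \<eta>_def)
          show "0 \<le> b k t" by (rule assms(11)[OF k elim(2)])
        qed
        then show ?case by (simp add: b_sum sum_distrib_left mult.commute)
      qed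
    qed (use assms(11,20,21) hD L A(1) R(1) quotient[OF A(3)] b_pos b_int(2) crit in \<open>auto simp: \<eta>_def\<close>)
    show ?thesis by (rule split.stable)
  qed
qed

end
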